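(* Let $\rho_h^{(1)}$ (for $h\in\mathbb{Z}\setminus\{0\}$), $\rho^{(2)}$, $\rho^{(3)}$ be the Wada representations $B_n\to\mathrm{Aut}(F_n)$ of types (1), (2), (3). (1) Let $k,l\in\mathbb{Z}\setminus\{0\}$. Then $\rho_k^{(1)}$ and $\rho_l^{(1)}$ are equivalent if and only if $l=\pm k$. (2) $\rho^{(2)}$ and $\rho^{(3)}$ are equivalent. (3) Let $k\in\mathbb{Z}\setminus\{0\}$. Then $\rho^{(2)}$ and $\rho_k^{(1)}$ are not equivalent.
   Context: $B_n$ is the braid group on $n$ strands with standard generators $\sigma_1,\dots,\sigma_{n-1}$, and $F_n$ is the free group of rank $n$ with fixed basis $x_1,\dots,x_n$. The Wada representations are the homomorphisms $B_n\to\mathrm{Aut}(F_n)$ determined as follows; in each case $\sigma_k$ fixes $x_i$ for $i\ne k,k+1$. Type (1), for $h\in\mathbb{Z}\setminus\{0\}$: $\rho_h^{(1)}(\sigma_k)(x_k)=x_k^{-h}x_{k+1}x_k^{h}$ and $\rho_h^{(1)}(\sigma_k)(x_{k+1})=x_k$. Type (2): $\rho^{(2)}(\sigma_k)(x_k)=x_kx_{k+1}^{-1}x_k$ and $\rho^{(2)}(\sigma_k)(x_{k+1})=x_k$. Type (3): $\rho^{(3)}(\sigma_k)(x_k)=x_k^2x_{k+1}$ and $\rho^{(3)}(\sigma_k)(x_{k+1})=x_{k+1}^{-1}x_k^{-1}x_{k+1}$. For a group $G$, two representations $\rho,\rho':B_n\to\mathrm{Aut}(G)$ are called equivalent if there exist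 automorphisms $\phi:G\to G$ and $\mu:B_n\to B_n$ such that $\rho'(\mu(\beta))=\phi^{-1}\circ\rho(\beta)\circ\phi$ for all $\beta\in B_n$. *)

theory Defs
  imports "HOL-Algebra.Algebra"
begin

section \<open>Free groups\<close>

text \<open>
  The letter \<open>(s, True)\<close> stands for the generator \<open>s\<close> and \<open>(s, False)\<close> for its formal inverse.
  \<open>word_equiv\<close> is the least equivalence relation that allows the insertion and deletion of
  a letter followed by its formal inverse.
\<close>

type_synonym 'a word = "('a \<times> bool) list"

inductive word_equiv :: "'a word \<Rightarrow> 'a word \<Rightarrow> bool" where
  cancel: "word_equiv (u @ [(s, b), (s, \<not> b)] @ v) (u @ v)"
| refl: "word_equiv u u"
| sym: "word_equiv u v \<Longrightarrow> word_equiv v u"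
| trans: "word_equiv u v \<Longrightarrow> word_equiv v w \<Longrightarrow> word_equiv u w"

definition word_rel :: "'a set \<Rightarrow> ('a word \<times> 'a word) set" where
  "word_rel S = {(u, v). u \<in> lists (S \<times> UNIV) \<and> v \<in> lists (S \<times> UNIV) \<and> word_equiv u v}"

definition free_group :: "'a set \<Rightarrow> 'a word set monoid" where
  "free_group S =
     \<lparr>carrier = lists (S \<times> UNIV) // word_rel S,
      monoid.mult = \<lambda>A B. \<Union>u\<in>A. \<Union>v\<in>B. word_rel S `` {u @ v},
      one = word_rel S `` {[]}\<rparr>"

definition free_gen :: "'a set \<Rightarrow> 'a \<Rightarrow> 'a word set" where
  "free_gen S s = word_rel S `` {[(s, True)]}"

lemma equiv_word_rel: "equiv (lists (S \<times> UNIV)) (word_rel S)"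
  by (rule equivI)
     (auto simp: word_rel_def refl_on_def sym_def trans_def
           intro: word_equiv.refl word_equiv.sym word_equiv.trans)

lemma word_equiv_append_left: "word_equiv u v \<Longrightarrow> word_equiv (w @ u) (w @ v)"
proof (induction rule: word_equiv.induct)
  case (cancel u s b v)
  show ?case using word_equiv.cancel[of "w @ u" s b v] by simp
qed (auto intro: word_equiv.refl word_equiv.sym word_equiv.trans)

lemma word_equiv_append_right: "word_equiv u v \<Longrightarrow> word_equiv (u @ w) (v @ w)"
proof (induction rule: word_equiv.induct)
  case (cancel u s b v)
  show ?case using word_equiv.cancel[of u s b "v @ w"] by simp
qed (auto intro: word_equiv.refl word_equiv.sym word_equiv.trans)

lemma word_equiv_append:
  "word_equiv u u' \<Longrightarrow> word_equiv v v' \<Longrightarrow> word_equiv (u @ v) (u' @ v')"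
  by (blast intro: word_equiv.trans word_equiv_append_left word_equiv_append_right)

lemma mult_free_group:
  assumes "u \<in> lists (S \<times> UNIV)" "v \<in> lists (S \<times> UNIV)"
  shows "word_rel S `` {u} \<otimes>\<^bsub>free_group S\<^esub> word_rel S `` {v} = word_rel S `` {u @ v}"
proof -
  have "word_rel S `` {u1 @ v1} = word_rel S `` {u2 @ v2}"
    if "(u1, u2) \<in> word_rel S" "(v1, v2) \<in> word_rel S" for u1 u2 v1 v2
  proof (rule equiv_class_eq[OF equiv_word_rel])
    show "(u1 @ v1, u2 @ v2) \<in> word_rel S"
      using that by (simp add: word_rel_def word_equiv_append)
  qed
  then have "congruent2 (word_rel S) (word_rel S) (\<lambda>u v. word_rel S `` {u @ v})"
    by (rule congruent2I')
  from UN_equiv_class2[OF equiv_word_rel equiv_word_rel this] show ?thesis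
    using assms by (simp add: free_group_def)
qed

lemma carrier_free_group:
  "carrier (free_group S) = (\<lambda>u. word_rel S `` {u}) ` lists (S \<times> UNIV)"
  by (auto simp: free_group_def quotient_def)

lemma word_equiv_inverse: "word_equiv (rev (map (apsnd Not) u) @ u) []"
proof (induction u)
  case (Cons a u)
  obtain s b where a: "a = (s, b)" by force
  have "word_equiv (rev (map (apsnd Not) u) @ [(s, \<not> b), (s, \<not> \<not> b)] @ u)
          (rev (map (apsnd Not) u) @ u)"
    by (rule word_equiv.cancel)
  then have "word_equiv (rev (map (apsnd Not) (a # u)) @ a # u) (rev (map (apsnd Not) u) @ u)"
    by (simp add: a)
  then show ?case using Cons by (rule word_equiv.trans)
qed (simp add: word_equiv.refl)

lemma group_free_group: "group (free_group S)"
proof (rule groupI)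
  fix x assume "x \<in> carrier (free_group S)"
  then obtain u where u: "u \<in> lists (S \<times> UNIV)" "x = word_rel S `` {u}"
    by (auto simp: carrier_free_group)
  let ?u = "rev (map (apsnd Not) u)"
  have u': "?u \<in> lists (S \<times> UNIV)" using u(1) by (force simp: in_lists_conv_set)
  moreover have "(?u @ u, []) \<in> word_rel S"
    using u' u(1) word_equiv_inverse[of u] unfolding word_rel_def by simp
  ultimately have "word_rel S `` {?u @ u} = word_rel S `` {[]}"
    by (intro equiv_class_eq[OF equiv_word_rel])
  then have "word_rel S `` {?u} \<otimes>\<^bsub>free_group S\<^esub> x = \<one>\<^bsub>free_group S\<^esub>"
    using u(2) mult_free_group[OF u' u(1)] by (simp add: free_group_def)
  then show "\<exists>y\<in>carrier (free_group S). y \<otimes>\<^bsub>free_group S\<^esub> x = \<one>\<^bsub>free_group S\<^esub>"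
    using u' by (auto simp: carrier_free_group)
next
  have one: "\<one>\<^bsub>free_group S\<^esub> = word_rel S `` {[]}" by (simp add: free_group_def)
  show "\<one>\<^bsub>free_group S\<^esub> \<in> carrier (free_group S)"
    unfolding one carrier_free_group by (rule imageI) simp
next
  have one: "\<one>\<^bsub>free_group S\<^esub> = word_rel S `` {[]}" by (simp add: free_group_def)
  fix x assume "x \<in> carrier (free_group S)"
  then obtain u where "u \<in> lists (S \<times> UNIV)" "x = word_rel S `` {u}"
    by (auto simp: carrier_free_group)
  then show "\<one>\<^bsub>free_group S\<^esub> \<otimes>\<^bsub>free_group S\<^esub> x = x"
    using mult_free_group[of "[]" S u] by (simp add: one)
next
  fix x y z
  assume "x \<in> carrier (free_group S)" "y \<in> carrier (free_group S)" "z \<in> carrier (free_group S)"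
  then obtain u v w
    where uvw: "u \<in> lists (S \<times> UNIV)" "v \<in> lists (S \<times> UNIV)" "w \<in> lists (S \<times> UNIV)"
      and x: "x = word_rel S `` {u}" "y = word_rel S `` {v}" "z = word_rel S `` {w}"
    unfolding carrier_free_group by blast
  have uv: "u @ v \<in> lists (S \<times> UNIV)" and vw: "v @ w \<in> lists (S \<times> UNIV)"
    using uvw by auto
  show "x \<otimes>\<^bsub>free_group S\<^esub> y \<in> carrier (free_group S)"
    unfolding x mult_free_group[OF uvw(1,2)] carrier_free_group using uv by blast
  show "x \<otimes>\<^bsub>free_group S\<^esub> y \<otimes>\<^bsub>free_group S\<^esub> z = x \<otimes>\<^bsub>free_group S\<^esub> (y \<otimes>\<^bsub>free_group S\<^esub> z)"
    unfolding x mult_free_group[OF uvw(1,2)] mult_free_group[OF uvw(2,3)]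
      mult_free_group[OF uv uvw(3)] mult_free_group[OF uvw(1) vw] by simp
qed

section \<open>Braid groups\<close>

definition normal_closure :: "('a, 'b) monoid_scheme \<Rightarrow> 'a set \<Rightarrow> 'a set" where
  "normal_closure G R = generate G {g \<otimes>\<^bsub>G\<^esub> r \<otimes>\<^bsub>G\<^esub> inv\<^bsub>G\<^esub> g | g r. g \<in> carrier G \<and> r \<in> R}"

definition braid_relators :: "nat \<Rightarrow> nat word set set" where
  "braid_relators n =
     (let F = free_group {1..<n}; s = free_gen {1..<n} in
       {(s i \<otimes>\<^bsub>F\<^esub> s j) \<otimes>\<^bsub>F\<^esub> inv\<^bsub>F\<^esub> (s j \<otimes>\<^bsub>F\<^esub> s i) | i j. 1 \<le> i \<and> i + 2 \<le> j \<and> j < n} \<union>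
       {(s i \<otimes>\<^bsub>F\<^esub> s (i + 1) \<otimes>\<^bsub>F\<^esub> s i) \<otimes>\<^bsub>F\<^esub> inv\<^bsub>F\<^esub> (s (i + 1) \<otimes>\<^bsub>F\<^esub> s i \<otimes>\<^bsub>F\<^esub> s (i + 1))
         | i. 1 \<le> i \<and> i + 1 < n})"

definition braid_group :: "nat \<Rightarrow> nat word set set monoid" where
  "braid_group n =
     free_group {1..<n} Mod normal_closure (free_group {1..<n}) (braid_relators n)"

definition braid_gen :: "nat \<Rightarrow> nat \<Rightarrow> nat word set set" where
  "braid_gen n k =
     normal_closure (free_group {1..<n}) (braid_relators n)
       #>\<^bsub>free_group {1..<n}\<^esub> free_gen {1..<n} k"

section \<open>Wada representations\<close>

abbreviation free_rank :: "nat \<Rightarrow> nat word set monoid" where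
  "free_rank n \<equiv> free_group {1..n}"

abbreviation basis :: "nat \<Rightarrow> nat \<Rightarrow> nat word set" where
  "basis n i \<equiv> free_gen {1..n} i"

text \<open>
  \<open>AutoGroup\<close> consists of extensional automorphisms under composition,
  \<open>(g \<otimes> f) y = g (f y)\<close>. Requiring the homomorphism itself to be extensional makes it unique,
  since the functions of HOL are also defined off the carrier.
\<close>

definition local_rep ::
  "nat \<Rightarrow> (nat word set \<Rightarrow> nat word set \<Rightarrow> nat word set) \<Rightarrow>
   (nat word set \<Rightarrow> nat word set \<Rightarrow> nat word set) \<Rightarrow>
   nat word set set \<Rightarrow> nat word set \<Rightarrow> nat word set" where
  "local_rep n U V =
     (THE \<rho>. \<rho> \<in> extensional (carrier (braid_group n)) \<and>
        \<rho> \<in> hom (braid_group n) (AutoGroup (free_rank n)) \<and>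
        (\<forall>k\<in>{1..<n}.
           \<rho> (braid_gen n k) (basis n k) = U (basis n k) (basis n (k + 1)) \<and>
           \<rho> (braid_gen n k) (basis n (k + 1)) = V (basis n k) (basis n (k + 1)) \<and>
           (\<forall>i\<in>{1..n} - {k, k + 1}. \<rho> (braid_gen n k) (basis n i) = basis n i)))"

definition wada1 :: "nat \<Rightarrow> int \<Rightarrow> nat word set set \<Rightarrow> nat word set \<Rightarrow> nat word set" where
  "wada1 n h =
     local_rep n
       (\<lambda>a b. a [^]\<^bsub>free_rank n\<^esub> (- h) \<otimes>\<^bsub>free_rank n\<^esub> b \<otimes>\<^bsub>free_rank n\<^esub> a [^]\<^bsub>free_rank n\<^esub> h)
       (\<lambda>a b. a)"

definition wada2 :: "nat \<Rightarrow> nat word set set \<Rightarrow> nat word set \<Rightarrow> nat word set" where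
  "wada2 n = local_rep n (\<lambda>a b. a \<otimes>\<^bsub>free_rank n\<^esub> inv\<^bsub>free_rank n\<^esub> b \<otimes>\<^bsub>free_rank n\<^esub> a) (\<lambda>a b. a)"

definition wada3 :: "nat \<Rightarrow> nat word set set \<Rightarrow> nat word set \<Rightarrow> nat word set" where
  "wada3 n =
     local_rep n
       (\<lambda>a b. a [^]\<^bsub>free_rank n\<^esub> (2::nat) \<otimes>\<^bsub>free_rank n\<^esub> b)
       (\<lambda>a b. inv\<^bsub>free_rank n\<^esub> b \<otimes>\<^bsub>free_rank n\<^esub> inv\<^bsub>free_rank n\<^esub> a \<otimes>\<^bsub>free_rank n\<^esub> b)"

definition rep_equivalent ::
  "('b, 'c) monoid_scheme \<Rightarrow> ('a, 'd) monoid_scheme \<Rightarrow>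
   ('b \<Rightarrow> 'a \<Rightarrow> 'a) \<Rightarrow> ('b \<Rightarrow> 'a \<Rightarrow> 'a) \<Rightarrow> bool" where
  "rep_equivalent B G \<rho> \<rho>' \<longleftrightarrow>
     (\<exists>\<phi>\<in>auto G. \<exists>\<mu>\<in>auto B. \<forall>\<beta>\<in>carrier B.
        \<rho>' (\<mu> \<beta>) = inv\<^bsub>AutoGroup G\<^esub> \<phi> \<otimes>\<^bsub>AutoGroup G\<^esub> \<rho> \<beta> \<otimes>\<^bsub>AutoGroup G\<^esub> \<phi>)"

end

theory Submission
  imports Defs
begin

text \<open>
  The type (1) representation of parameter \<open>h\<close> fixes \<open>x\<^sub>n\<^sup>h \<dots> x\<^sub>1\<^sup>h\<close>. Conversely, modulo the \<open>h\<close>-th powers of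
  the basis, \<open>\<sigma>\<^sub>k\<close> merely exchanges two factors of a free product of cyclic groups of order \<open>h\<close>, so
  every common fixed point of the representation has exponent sums divisible by \<open>h\<close>. An equivalence
  carries fixed points to fixed points, whatever the automorphism of the braid group is, so equivalent
  representations have parameters dividing each other. Inverting the basis exchanges \<open>h\<close> and \<open>-h\<close>.

  Types (2) and (3) are related by an explicit change of basis. On the abelianization the type (1)
  representations permute the basis, whereas \<open>\<sigma>\<^sub>1\<close> acts with an infinite orbit in type (2).
\<close>

section \<open>Generators and homomorphisms\<close>

text \<open>Since \<open>\<mu>\<close> is arbitrary, nothing is known about the image of a single
  braid generator, so the invariants must concern the whole image of a representation: its common
  fixed points, and the boundedness of exponent sums along an orbit. Divisibility survives the
  passage through \<open>\<phi>\<close> because the first exponent sum composed with the inverse of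
  \<open>\<phi>\<close> is an integer combination of all exponent sums. Applied to the image of
  \<open>x_n^l ... x_1^l\<close>, which is fixed by the representation of parameter
  \<open>k\<close>, this gives that \<open>k\<close> divides \<open>l\<close>.

  A second obstacle is that \<open>local_rep\<close> is a definite description: nothing can be said
  about it before a homomorphism with the prescribed values is known to exist and to be unique.
  Types (1) and (2) both send \<open>x_(k+1)\<close> to \<open>x_k\<close>, so a single criterion
  produces them. For type (3) the braid relations are never checked: conjugating type (2) by the
  change of basis yields a homomorphism with the type (3) values, and uniqueness identifies
  it.\<close>

lemma group_homI: "group G \<Longrightarrow> group H \<Longrightarrow> f \<in> hom G H \<Longrightarrow> group_hom G H f"
  by (simp add: group_hom_def group_hom_axioms_def)

lemma hom_eq_on_generate:
  assumes "group G" "group H" "f \<in> hom G H" "g \<in> hom G H" "A \<subseteq> carrier G"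
    and "\<And>a. a \<in> A \<Longrightarrow> f a = g a" and "x \<in> generate G A"
  shows "f x = g x"
proof -
  interpret f: group_hom G H f using assms by (intro group_homI)
  interpret g: group_hom G H g using assms by (intro group_homI)
  show ?thesis using assms(7)
  proof (induction rule: generate.induct)
    case (eng x y)
    then show ?case using f.G.generate_in_carrier[OF assms(5)] by simp
  qed (use assms(5,6) in \<open>auto simp: subset_iff\<close>)
qed

lemma free_gen_closed [simp]: "s \<in> S \<Longrightarrow> free_gen S s \<in> carrier (free_group S)"
  unfolding carrier_free_group free_gen_def by (intro imageI) (simp add: lists.intros)

lemma inv_free_gen:
  assumes "s \<in> S"
  shows "inv\<^bsub>free_group S\<^esub> (free_gen S s) = word_rel S `` {[(s, False)]}"
proof (rule group.inv_equality[OF group_free_group])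
  have "([(s, False), (s, True)], []) \<in> word_rel S"
    using assms word_equiv.cancel[of "[]" s False "[]"] by (simp add: word_rel_def)
  then have "word_rel S `` {[(s, False), (s, True)]} = word_rel S `` {[]}"
    by (rule equiv_class_eq[OF equiv_word_rel])
  then show "word_rel S `` {[(s, False)]} \<otimes>\<^bsub>free_group S\<^esub> free_gen S s = \<one>\<^bsub>free_group S\<^esub>"
    using assms by (simp add: free_gen_def mult_free_group) (simp add: free_group_def)
  show "word_rel S `` {[(s, False)]} \<in> carrier (free_group S)"
    unfolding carrier_free_group using assms by (intro imageI) (simp add: lists.intros)
qed (use assms in simp)

lemma generate_free_gen: "generate (free_group S) (free_gen S ` S) = carrier (free_group S)"
proof
  show "generate (free_group S) (free_gen S ` S) \<subseteq> carrier (free_group S)"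
    by (rule group.generate_incl[OF group_free_group]) (auto intro: free_gen_closed)
  have "word_rel S `` {u} \<in> generate (free_group S) (free_gen S ` S)" if "u \<in> lists (S \<times> UNIV)" for u
    using that
  proof (induction u)
    case Nil
    then show ?case using generate.one[of "free_group S"] by (simp add: free_group_def)
  next
    case (Cons a u)
    obtain s b where a: "a = (s, b)" by force
    have s: "s \<in> S" using Cons a by simp
    have "word_rel S `` {[a]} \<in> generate (free_group S) (free_gen S ` S)"
    proof (cases b)
      case True
      then show ?thesis
        using s generate.incl[of "free_gen S s" "free_gen S ` S" "free_group S"]
        by (simp add: a free_gen_def)
    next
      case False
      then show ?thesis
        using s generate.inv[of "free_gen S s" "free_gen S ` S" "free_group S"]
        by (simp add: a inv_free_gen)
    qed
    from generate.eng[OF this Cons.IH] show ?case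
      using s Cons.hyps mult_free_group[of "[a]" S u] by (simp add: a)
  qed
  then show "carrier (free_group S) \<subseteq> generate (free_group S) (free_gen S ` S)"
    by (auto simp: carrier_free_group)
qed

lemma free_group_hom_eqI:
  assumes "group H" "f \<in> hom (free_group S) H" "g \<in> hom (free_group S) H"
    and "\<And>s. s \<in> S \<Longrightarrow> f (free_gen S s) = g (free_gen S s)" and "x \<in> carrier (free_group S)"
  shows "f x = g x"
proof (rule hom_eq_on_generate[OF group_free_group assms(1-3)])
  show "x \<in> generate (free_group S) (free_gen S ` S)"
    using assms(5) by (simp add: generate_free_gen)
qed (use assms(4) in auto)

section \<open>Universal property of the free group\<close>

context group
begin

primrec eval_word :: "('c \<Rightarrow> 'a) \<Rightarrow> 'c word \<Rightarrow> 'a" where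
  "eval_word f [] = \<one>"
| "eval_word f (a # u) = (if snd a then f (fst a) else inv (f (fst a))) \<otimes> eval_word f u"

lemma eval_word_closed [simp]:
  "f \<in> UNIV \<rightarrow> carrier G \<Longrightarrow> eval_word f u \<in> carrier G"
  by (induction u) (auto simp: Pi_iff)

lemma eval_word_append:
  "f \<in> UNIV \<rightarrow> carrier G \<Longrightarrow> eval_word f (u @ v) = eval_word f u \<otimes> eval_word f v"
  by (induction u) (auto simp: m_assoc Pi_iff)

lemma eval_word_equiv:
  assumes "word_equiv u v" "f \<in> UNIV \<rightarrow> carrier G"
  shows "eval_word f u = eval_word f v"
  using assms(1)
proof (induction rule: word_equiv.induct)
  case (cancel u s b v)
  have "f s \<in> carrier G" using assms(2) by auto
  then have "eval_word f [(s, b), (s, \<not> b)] = \<one>" by simp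
  then show ?case using assms(2) by (simp only: eval_word_append l_one eval_word_closed)
qed auto

lemma free_group_universal:
  assumes "f \<in> S \<rightarrow> carrier G"
  shows "\<exists>\<phi>\<in>hom (free_group S) G. \<forall>s\<in>S. \<phi> (free_gen S s) = f s"
proof -
  \<comment> \<open>The value 1 off \<open>S\<close> is needed because \<open>word_equiv\<close> may
    pass through words with letters outside \<open>S\<close>, even between two words over
    \<open>S\<close>; evaluation must be invariant along all of them.\<close>
  define f' where "f' s = (if s \<in> S then f s else \<one>)" for s
  have f': "f' \<in> UNIV \<rightarrow> carrier G" using assms by (auto simp: f'_def)
  define \<phi> where "\<phi> A = eval_word f' (SOME u. u \<in> A)" for A
  have \<phi>: "\<phi> (word_rel S `` {u}) = eval_word f' u" if "u \<in> lists (S \<times> UNIV)" for u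
  proof -
    have "u \<in> word_rel S `` {u}" using that by (auto simp: word_rel_def word_equiv.refl)
    then have "(SOME v. v \<in> word_rel S `` {u}) \<in> word_rel S `` {u}" by (rule someI)
    then have "(u, SOME v. v \<in> word_rel S `` {u}) \<in> word_rel S" by (simp only: Image_singleton_iff)
    then have "word_equiv u (SOME v. v \<in> word_rel S `` {u})" unfolding word_rel_def by blast
    then show ?thesis unfolding \<phi>_def using eval_word_equiv f' by metis
  qed
  have "\<phi> \<in> hom (free_group S) G"
  proof (rule homI)
    fix x y assume "x \<in> carrier (free_group S)" "y \<in> carrier (free_group S)"
    then obtain u v where uv: "u \<in> lists (S \<times> UNIV)" "v \<in> lists (S \<times> UNIV)"
      and x: "x = word_rel S `` {u}" "y = word_rel S `` {v}"
      unfolding carrier_free_group by blast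
    then show "\<phi> (x \<otimes>\<^bsub>free_group S\<^esub> y) = \<phi> x \<otimes> \<phi> y"
      using f' by (simp only: x mult_free_group[OF uv] \<phi> eval_word_append append_in_lists_conv)
    next
    fix x assume "x \<in> carrier (free_group S)"
    then obtain u where "u \<in> lists (S \<times> UNIV)" "x = word_rel S `` {u}"
      unfolding carrier_free_group by blast
    then show "\<phi> x \<in> carrier G" using \<phi> f' by simp
  qed
  moreover have "\<phi> (free_gen S s) = f s" if "s \<in> S" for s
  proof -
    have "f s \<in> carrier G" using that assms by auto
    then show ?thesis using that by (simp add: free_gen_def \<phi> f'_def)
  qed
  ultimately show ?thesis by blast
qed

end

definition free_lift :: "'s set \<Rightarrow> ('a, 'b) monoid_scheme \<Rightarrow> ('s \<Rightarrow> 'a) \<Rightarrow> 's word set \<Rightarrow> 'a" where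
  "free_lift S G f = (SOME \<phi>. \<phi> \<in> hom (free_group S) G \<and> (\<forall>s\<in>S. \<phi> (free_gen S s) = f s))"

lemma
  assumes "group G" "\<And>s. s \<in> S \<Longrightarrow> f s \<in> carrier G"
  shows free_lift_hom: "free_lift S G f \<in> hom (free_group S) G"
    and free_lift_gen: "s \<in> S \<Longrightarrow> free_lift S G f (free_gen S s) = f s"
proof -
  have "free_lift S G f \<in> hom (free_group S) G \<and> (\<forall>s\<in>S. free_lift S G f (free_gen S s) = f s)"
    unfolding free_lift_def using group.free_group_universal[OF assms(1), of f S] assms(2)
    by (intro someI_ex[where P = "\<lambda>\<phi>. \<phi> \<in> hom (free_group S) G \<and> (\<forall>s\<in>S. \<phi> (free_gen S s) = f s)"]) blast
  then show "free_lift S G f \<in> hom (free_group S) G"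
    and "s \<in> S \<Longrightarrow> free_lift S G f (free_gen S s) = f s" by auto
qed

section \<open>Automorphisms\<close>

lemma carrier_AutoGroup [simp]: "carrier (AutoGroup G) = auto G"
  by (simp add: AutoGroup_def)

lemma one_AutoGroup [simp]: "\<one>\<^bsub>AutoGroup G\<^esub> = (\<lambda>x\<in>carrier G. x)"
  by (simp add: AutoGroup_def BijGroup_def)

lemma mult_AutoGroup:
  "f \<in> auto G \<Longrightarrow> g \<in> auto G \<Longrightarrow> f \<otimes>\<^bsub>AutoGroup G\<^esub> g = compose (carrier G) f g"
  by (simp add: AutoGroup_def BijGroup_def auto_def)

lemma autoD:
  assumes "f \<in> auto G"
  shows "f \<in> hom G G" "f \<in> extensional (carrier G)" "bij_betw f (carrier G) (carrier G)"
  using assms by (auto simp: auto_def Bij_def)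

lemma auto_closed: "f \<in> auto G \<Longrightarrow> x \<in> carrier G \<Longrightarrow> f x \<in> carrier G"
  using autoD(1) hom_in_carrier by fast

lemma auto_eqI:
  assumes "f \<in> auto G" "g \<in> auto G" "\<And>x. x \<in> carrier G \<Longrightarrow> f x = g x"
  shows "f = g"
  using assms autoD(2) extensionalityI by metis

lemma mult_AutoGroup_apply:
  "f \<in> auto G \<Longrightarrow> g \<in> auto G \<Longrightarrow> x \<in> carrier G \<Longrightarrow> (f \<otimes>\<^bsub>AutoGroup G\<^esub> g) x = f (g x)"
  by (simp add: mult_AutoGroup compose_def)

lemma restrict_autoI:
  assumes "group G" "f \<in> hom G G" "g \<in> hom G G"
    and "\<And>x. x \<in> carrier G \<Longrightarrow> f (g x) = x" "\<And>x. x \<in> carrier G \<Longrightarrow> g (f x) = x"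
  shows "restrict f (carrier G) \<in> auto G"
proof -
  interpret group G by fact
  have "bij_betw f (carrier G) (carrier G)"
    using assms by (intro bij_betwI[where g = g]) (auto simp: hom_def)
  then show ?thesis using assms(2) by (auto simp: auto_def Bij_def hom_def Pi_iff)
qed

lemma auto_free_group_eqI:
  assumes "f \<in> auto (free_group S)" "g \<in> auto (free_group S)"
    and "\<And>s. s \<in> S \<Longrightarrow> f (free_gen S s) = g (free_gen S s)"
  shows "f = g"
  by (rule auto_eqI[OF assms(1,2)])
    (rule free_group_hom_eqI[OF group_free_group autoD(1)[OF assms(1)] autoD(1)[OF assms(2)] assms(3)])

section \<open>Representations of the braid group\<close>

lemma braid_relators_closed: "braid_relators n \<subseteq> carrier (free_group {1..<n})"
proof -
  interpret group "free_group {1..<n}" by (rule group_free_group)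
  show ?thesis unfolding braid_relators_def Let_def
    by (intro Un_least subsetI; elim CollectE exE conjE; hypsubst;
        intro m_closed inv_closed free_gen_closed) auto
qed

text \<open>The set of all conjugates of \<open>R\<close> is itself stable under conjugation, so the
  subgroup it generates is normal.\<close>

lemma (in group) normal_normal_closure:
  assumes "R \<subseteq> carrier G"
  shows "normal_closure G R \<lhd> G"
  unfolding normal_closure_def
proof (rule normal_generateI)
  fix h g assume "h \<in> {g \<otimes> r \<otimes> inv g |g r. g \<in> carrier G \<and> r \<in> R}" and g: "g \<in> carrier G"
  then obtain g' r where h: "h = g' \<otimes> r \<otimes> inv g'" "g' \<in> carrier G" "r \<in> R" by blast
  then have "g \<otimes> h \<otimes> inv g = (g \<otimes> g') \<otimes> r \<otimes> inv (g \<otimes> g')"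
    using g assms by (auto simp: m_assoc inv_mult_group subset_iff)
  then show "g \<otimes> h \<otimes> inv g \<in> {g \<otimes> r \<otimes> inv g |g r. g \<in> carrier G \<and> r \<in> R}"
    using g h by blast
qed (use assms in auto)

lemma (in group_hom) normal_closure_subset_kernel:
  assumes "R \<subseteq> kernel G H h"
  shows "normal_closure G R \<subseteq> kernel G H h"
  unfolding normal_closure_def
  by (rule G.generate_subgroup_incl[OF _ subgroup_kernel]) (use assms in \<open>auto simp: kernel_def\<close>)

lemma normal_braid_closure:
  "normal_closure (free_group {1..<n}) (braid_relators n) \<lhd> free_group {1..<n}"
  by (rule group.normal_normal_closure[OF group_free_group braid_relators_closed])

lemma group_braid_group: "group (braid_group n)"
  unfolding braid_group_def by (rule normal.factorgroup_is_group[OF normal_braid_closure])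

lemma generate_braid_gen: "generate (braid_group n) (braid_gen n ` {1..<n}) = carrier (braid_group n)"
proof -
  let ?F = "free_group {1..<n}"
  let ?N = "normal_closure ?F (braid_relators n)"
  interpret N: normal ?N ?F by (rule normal_braid_closure)
  interpret B: group "braid_group n" by (rule group_braid_group)
  interpret p: group_hom ?F "braid_group n" "\<lambda>a. ?N #>\<^bsub>?F\<^esub> a"
    using N.r_coset_hom_Mod by (intro group_homI N.is_group B.is_group) (simp only: braid_group_def)
  have "braid_gen n ` {1..<n} = (\<lambda>a. ?N #>\<^bsub>?F\<^esub> a) ` (free_gen {1..<n} ` {1..<n})"
    by (auto simp: braid_gen_def)
  also have "generate (braid_group n) \<dots> =
      (\<lambda>a. ?N #>\<^bsub>?F\<^esub> a) ` generate ?F (free_gen {1..<n} ` {1..<n})"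
    by (rule p.generate_img) auto
  also have "\<dots> = carrier (braid_group n)"
    by (auto simp: generate_free_gen braid_group_def FactGroup_def RCOSETS_def)
  finally show ?thesis .
qed

lemma braid_gen_closed [simp]: "k \<in> {1..<n} \<Longrightarrow> braid_gen n k \<in> carrier (braid_group n)"
  using generate_braid_gen[of n] generate.incl[of "braid_gen n k"] by blast

text \<open>The relations put the relators into the kernel of the lift to the free group; kernels
  are normal, hence contain the normal closure, and the lift factors through the quotient.\<close>

lemma braid_group_universal:
  assumes "group H" and s: "\<And>k. k \<in> {1..<n} \<Longrightarrow> s k \<in> carrier H"
    and far: "\<And>i j. 1 \<le> i \<Longrightarrow> i + 2 \<le> j \<Longrightarrow> j < n \<Longrightarrow> s i \<otimes>\<^bsub>H\<^esub> s j = s j \<otimes>\<^bsub>H\<^esub> s i"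
    and near: "\<And>i. 1 \<le> i \<Longrightarrow> i + 1 < n \<Longrightarrow>
      s i \<otimes>\<^bsub>H\<^esub> s (i + 1) \<otimes>\<^bsub>H\<^esub> s i = s (i + 1) \<otimes>\<^bsub>H\<^esub> s i \<otimes>\<^bsub>H\<^esub> s (i + 1)"
  shows "\<exists>\<rho>\<in>hom (braid_group n) H. \<forall>k\<in>{1..<n}. \<rho> (braid_gen n k) = s k"
proof -
  let ?F = "free_group {1..<n}"
  let ?N = "normal_closure ?F (braid_relators n)"
  let ?f = "free_lift {1..<n} H s"
  have hom: "?f \<in> hom ?F H" by (rule free_lift_hom[OF assms(1) s])
  have gen [simp]: "?f (free_gen {1..<n} k) = s k" if "k \<in> {1..<n}" for k
    by (rule free_lift_gen[OF assms(1) s that])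
  interpret F: group ?F by (rule group_free_group)
  interpret H: group H by fact
  interpret f: group_hom ?F H ?f using hom by unfold_locales
  have "r \<in> kernel ?F H ?f" if "r \<in> braid_relators n" for r
    using that unfolding braid_relators_def Let_def
  proof (elim UnE CollectE exE conjE)
    fix i j assume ij: "1 \<le> i" "i + 2 \<le> j" "j < n"
    then have [simp]: "i \<in> {1..<n}" "j \<in> {1..<n}" by auto
    show "r \<in> kernel ?F H ?f"
      if "r = (free_gen {1..<n} i \<otimes>\<^bsub>?F\<^esub> free_gen {1..<n} j) \<otimes>\<^bsub>?F\<^esub>
        inv\<^bsub>?F\<^esub> (free_gen {1..<n} j \<otimes>\<^bsub>?F\<^esub> free_gen {1..<n} i)"
      using far[OF ij] by (simp add: that kernel_def s del: atLeastLessThan_iff One_nat_def)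
  next
    fix i assume i: "1 \<le> i" "i + 1 < n"
    then have [simp]: "i \<in> {1..<n}" "i + 1 \<in> {1..<n}" by auto
    show "r \<in> kernel ?F H ?f"
      if "r = (free_gen {1..<n} i \<otimes>\<^bsub>?F\<^esub> free_gen {1..<n} (i + 1) \<otimes>\<^bsub>?F\<^esub> free_gen {1..<n} i) \<otimes>\<^bsub>?F\<^esub>
        inv\<^bsub>?F\<^esub> (free_gen {1..<n} (i + 1) \<otimes>\<^bsub>?F\<^esub> free_gen {1..<n} i \<otimes>\<^bsub>?F\<^esub> free_gen {1..<n} (i + 1))"
      using near[OF i] by (simp add: that kernel_def s del: atLeastLessThan_iff add_Suc_right One_nat_def)
  qed
  then have N: "?N \<subseteq> kernel ?F H ?f"
    by (intro f.normal_closure_subset_kernel) blast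
  show ?thesis
  proof (rule f.FactGroup_universal_kernel[OF normal_braid_closure N])
    fix g assume g: "g \<in> hom (?F Mod ?N) H" "\<And>x. x \<in> carrier ?F \<Longrightarrow> g (?N #>\<^bsub>?F\<^esub> x) = ?f x"
    show ?thesis
      using g by (intro bexI[of _ g] ballI)
        (simp_all add: braid_group_def braid_gen_def del: atLeastLessThan_iff One_nat_def)
  qed
qed

text \<open>The predicate under the definite description in \<open>local_rep\<close>, named so that
  existence and uniqueness can be treated separately.\<close>

definition is_local_rep where
  "is_local_rep n U V \<rho> \<longleftrightarrow> \<rho> \<in> extensional (carrier (braid_group n)) \<and>
     \<rho> \<in> hom (braid_group n) (AutoGroup (free_rank n)) \<and>
     (\<forall>k\<in>{1..<n}.
        \<rho> (braid_gen n k) (basis n k) = U (basis n k) (basis n (k + 1)) \<and>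
        \<rho> (braid_gen n k) (basis n (k + 1)) = V (basis n k) (basis n (k + 1)) \<and>
        (\<forall>i\<in>{1..n} - {k, k + 1}. \<rho> (braid_gen n k) (basis n i) = basis n i))"

lemma group_AutoGroup_free_rank: "group (AutoGroup (free_rank n))"
  by (rule group.AutoGroup[OF group_free_group])

text \<open>A representation is determined by finitely many values: each automorphism by its values
  on the basis, and the homomorphism by its values on the braid generators.\<close>

lemma braid_rep_eqI:
  assumes "\<rho> \<in> hom (braid_group n) (AutoGroup (free_rank n))"
    and "\<rho>' \<in> hom (braid_group n) (AutoGroup (free_rank n))"
    and "\<And>k i. k \<in> {1..<n} \<Longrightarrow> i \<in> {1..n} \<Longrightarrow>
      \<rho> (braid_gen n k) (basis n i) = \<rho>' (braid_gen n k) (basis n i)"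
    and "\<beta> \<in> carrier (braid_group n)"
  shows "\<rho> \<beta> = \<rho>' \<beta>"
proof (rule hom_eq_on_generate[OF group_braid_group group_AutoGroup_free_rank assms(1,2)])
  fix a assume "a \<in> braid_gen n ` {1..<n}"
  then obtain k where k: "a = braid_gen n k" "k \<in> {1..<n}" by blast
  then have "\<rho> a \<in> auto (free_rank n)" "\<rho>' a \<in> auto (free_rank n)"
    using hom_in_carrier[OF assms(1), of a] hom_in_carrier[OF assms(2), of a] by simp_all
  then show "\<rho> a = \<rho>' a"
    by (rule auto_free_group_eqI) (simp only: k assms(3))
qed (use assms(4) in \<open>auto simp: generate_braid_gen simp del: One_nat_def\<close>)

lemma is_local_repD:
  assumes "is_local_rep n U V \<rho>"
  shows "\<rho> \<in> extensional (carrier (braid_group n))"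
    and "\<rho> \<in> hom (braid_group n) (AutoGroup (free_rank n))"
    and "\<lbrakk>k \<in> {1..<n}; i \<in> {1..n}\<rbrakk> \<Longrightarrow> \<rho> (braid_gen n k) (basis n i) =
      (if i = k then U (basis n k) (basis n (k + 1))
       else if i = k + 1 then V (basis n k) (basis n (k + 1)) else basis n i)"
proof -
  note * = assms[unfolded is_local_rep_def]
  show "\<rho> \<in> extensional (carrier (braid_group n))"
    by (rule conjunct1[OF *])
  show "\<rho> \<in> hom (braid_group n) (AutoGroup (free_rank n))"
    by (rule conjunct1[OF conjunct2[OF *]])
  assume k: "k \<in> {1..<n}" and i: "i \<in> {1..n}"
  note ** = bspec[OF conjunct2[OF conjunct2[OF *]] k]
  show "\<rho> (braid_gen n k) (basis n i) =
      (if i = k then U (basis n k) (basis n (k + 1))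
       else if i = k + 1 then V (basis n k) (basis n (k + 1)) else basis n i)"
    using conjunct1[OF **] conjunct1[OF conjunct2[OF **]] bspec[OF conjunct2[OF conjunct2[OF **]], of i] i
    by (simp del: One_nat_def add_Suc_right)
qed

lemma is_local_rep_unique:
  assumes "is_local_rep n U V \<rho>" "is_local_rep n U V \<rho>'"
  shows "\<rho> = \<rho>'"
proof (rule extensionalityI[where A = "carrier (braid_group n)"])
  fix \<beta> assume \<beta>: "\<beta> \<in> carrier (braid_group n)"
  show "\<rho> \<beta> = \<rho>' \<beta>"
  proof (rule braid_rep_eqI[OF _ _ _ \<beta>])
    fix k i assume "k \<in> {1..<n}" "i \<in> {1..n}"
    then show "\<rho> (braid_gen n k) (basis n i) = \<rho>' (braid_gen n k) (basis n i)"
      by (simp only: is_local_repD(3)[OF assms(1)] is_local_repD(3)[OF assms(2)])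
  qed (fact is_local_repD(2)[OF assms(1)] is_local_repD(2)[OF assms(2)])+
qed (fact is_local_repD(1)[OF assms(1)] is_local_repD(1)[OF assms(2)])+

lemma local_rep_eqI:
  assumes "is_local_rep n U V \<rho>"
  shows "local_rep n U V = \<rho>"
proof -
  have "local_rep n U V = (THE \<rho>. is_local_rep n U V \<rho>)"
    by (simp only: local_rep_def is_local_rep_def)
  also have "\<dots> = \<rho>"
  proof (rule the_equality)
    fix \<rho>' assume "is_local_rep n U V \<rho>'"
    then show "\<rho>' = \<rho>" using assms by (rule is_local_rep_unique)
  qed (rule assms)
  finally show ?thesis .
qed

section \<open>Local representations from self-distributive operations\<close>

lemma (in group)
  assumes "a \<in> carrier G" "x \<in> carrier G"
  shows mult_inv_cancel: "a \<otimes> (inv a \<otimes> x) = x"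
    and inv_mult_cancel: "inv a \<otimes> (a \<otimes> x) = x"
  using assms by (simp_all flip: m_assoc)

text \<open>Conjugation by \<open>a\<close> is an endomorphism and commutes with powers. The
  right-nested form matches terms normalised by \<open>m_assoc\<close>; with a power in place of
  \<open>a\<close>, it is what makes the type (1) operation self-distributive.\<close>

lemma (in group) int_pow_conjugate:
  assumes "a \<in> carrier G" "b \<in> carrier G"
  shows "(inv a \<otimes> (b \<otimes> a)) [^] (h::int) = inv a \<otimes> (b [^] h \<otimes> a)"
proof -
  have "(\<lambda>b. inv a \<otimes> (b \<otimes> a)) \<in> hom G G"
    using assms by (auto intro!: homI simp: m_assoc mult_inv_cancel)
  from hom_int_pow[OF this assms(2) is_group is_group] show ?thesis by simp
qed

lemma free_group_hom_eq_id:
  assumes "f \<in> hom (free_group S) (free_group S)" "\<And>s. s \<in> S \<Longrightarrow> f (free_gen S s) = free_gen S s"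
    and "x \<in> carrier (free_group S)"
  shows "f x = x"
  using free_group_hom_eqI[OF group_free_group assms(1), of "\<lambda>x. x"] assms(2,3)
  by (simp add: hom_def)

lemma hom_comp: "f \<in> hom G H \<Longrightarrow> g \<in> hom H K \<Longrightarrow> (\<lambda>x. g (f x)) \<in> hom G K"
  by (auto simp: hom_def Pi_iff)

text \<open>
  The braid relations for \<open>x\<^sub>k \<mapsto> U x\<^sub>k x\<^sub>k\<^sub>+\<^sub>1\<close>, \<open>x\<^sub>k\<^sub>+\<^sub>1 \<mapsto> x\<^sub>k\<close> amount to left self-distributivity of \<open>U\<close>.
\<close>

locale free_rack =
  fixes n :: nat and U U' :: "nat word set \<Rightarrow> nat word set \<Rightarrow> nat word set"
  assumes U_closed [simp]: "\<lbrakk>a \<in> carrier (free_rank n); b \<in> carrier (free_rank n)\<rbrakk> \<Longrightarrow> U a b \<in> carrier (free_rank n)"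
    and U'_closed [simp]: "\<lbrakk>a \<in> carrier (free_rank n); b \<in> carrier (free_rank n)\<rbrakk> \<Longrightarrow> U' a b \<in> carrier (free_rank n)"
    and hom_U: "\<lbrakk>f \<in> hom (free_rank n) (free_rank n); a \<in> carrier (free_rank n); b \<in> carrier (free_rank n)\<rbrakk>
      \<Longrightarrow> f (U a b) = U (f a) (f b)"
    and hom_U': "\<lbrakk>f \<in> hom (free_rank n) (free_rank n); a \<in> carrier (free_rank n); b \<in> carrier (free_rank n)\<rbrakk>
      \<Longrightarrow> f (U' a b) = U' (f a) (f b)"
    and U_U' [simp]: "\<lbrakk>a \<in> carrier (free_rank n); b \<in> carrier (free_rank n)\<rbrakk> \<Longrightarrow> U a (U' a b) = b"
    and U'_U [simp]: "\<lbrakk>a \<in> carrier (free_rank n); b \<in> carrier (free_rank n)\<rbrakk> \<Longrightarrow> U' a (U a b) = b"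
    and U_distrib: "\<lbrakk>a \<in> carrier (free_rank n); b \<in> carrier (free_rank n); c \<in> carrier (free_rank n)\<rbrakk>
      \<Longrightarrow> U (U a b) (U a c) = U a (U b c)"
begin

definition twist :: "nat \<Rightarrow> nat word set \<Rightarrow> nat word set" where
  "twist k = free_lift {1..n} (free_rank n)
     (\<lambda>i. if i = k then U (basis n k) (basis n (k + 1)) else if i = k + 1 then basis n k else basis n i)"

text \<open>Solves the equations defining \<open>twist k\<close>: \<open>x_k\<close> is the image of
  \<open>x_(k+1)\<close>, and \<open>x_(k+1)\<close> is recovered from \<open>U x_k x_(k+1)\<close>
  by \<open>U' x_k\<close>. Pulling this back puts \<open>x_(k+1)\<close> first and
  \<open>x_k\<close> second.\<close>

definition untwist :: "nat \<Rightarrow> nat word set \<Rightarrow> nat word set" where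
  "untwist k = free_lift {1..n} (free_rank n)
     (\<lambda>i. if i = k then basis n (k + 1) else if i = k + 1 then U' (basis n (k + 1)) (basis n k) else basis n i)"

context
  fixes k assumes k: "k \<in> {1..<n}"
begin

lemma index_in_range [simp]: "k \<in> {1..n}" "k + 1 \<in> {1..n}"
  using k by auto

lemma twist_hom: "twist k \<in> hom (free_rank n) (free_rank n)"
  unfolding twist_def by (rule free_lift_hom[OF group_free_group]) (simp del: One_nat_def add_Suc_right atLeastAtMost_iff)

lemma untwist_hom: "untwist k \<in> hom (free_rank n) (free_rank n)"
  unfolding untwist_def by (rule free_lift_hom[OF group_free_group]) (simp del: One_nat_def add_Suc_right atLeastAtMost_iff)

lemma twist_gen: "i \<in> {1..n} \<Longrightarrow> twist k (basis n i) =
    (if i = k then U (basis n k) (basis n (k + 1)) else if i = k + 1 then basis n k else basis n i)"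
  unfolding twist_def by (subst free_lift_gen[OF group_free_group]) (simp_all del: One_nat_def add_Suc_right atLeastAtMost_iff)

lemma untwist_gen: "i \<in> {1..n} \<Longrightarrow> untwist k (basis n i) =
    (if i = k then basis n (k + 1) else if i = k + 1 then U' (basis n (k + 1)) (basis n k) else basis n i)"
  unfolding untwist_def by (subst free_lift_gen[OF group_free_group]) (simp_all del: One_nat_def add_Suc_right atLeastAtMost_iff)

lemma twist_auto: "restrict (twist k) (carrier (free_rank n)) \<in> auto (free_rank n)"
proof (rule restrict_autoI[OF group_free_group twist_hom untwist_hom])
  fix x assume x: "x \<in> carrier (free_rank n)"
  show "twist k (untwist k x) = x"
    by (rule free_group_hom_eq_id[OF hom_comp[OF untwist_hom twist_hom] _ x])
      (simp add: twist_gen untwist_gen hom_U'[OF twist_hom] del: One_nat_def add_Suc_right atLeastAtMost_iff)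
  show "untwist k (twist k x) = x"
    by (rule free_group_hom_eq_id[OF hom_comp[OF twist_hom untwist_hom] _ x])
      (simp add: twist_gen untwist_gen hom_U[OF untwist_hom] del: One_nat_def add_Suc_right atLeastAtMost_iff)
qed

end

lemma local_rep_exists: "\<exists>\<rho>. is_local_rep n U (\<lambda>a b. a) \<rho>"
proof -
  let ?F = "free_rank n"
  define s where "s k = restrict (twist k) (carrier ?F)" for k
  have s_auto [simp]: "s k \<in> auto ?F" if "k \<in> {1..<n}" for k
    unfolding s_def by (rule twist_auto[OF that])
  have s_gen: "s k (basis n i) =
      (if i = k then U (basis n k) (basis n (k + 1)) else if i = k + 1 then basis n k else basis n i)"
    if "k \<in> {1..<n}" "i \<in> {1..n}" for k i
    using that twist_gen by (simp add: s_def)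
  have s_U: "s k (U a b) = U (s k a) (s k b)"
    if "k \<in> {1..<n}" "a \<in> carrier ?F" "b \<in> carrier ?F" for k a b
    using that hom_U[OF autoD(1)[OF s_auto]] by blast
  note rules = mult_AutoGroup_apply s_gen s_U auto_closed
  have A: "group (AutoGroup ?F)" by (rule group_AutoGroup_free_rank)
  have mult_auto: "f \<otimes>\<^bsub>AutoGroup ?F\<^esub> g \<in> auto ?F" if "f \<in> auto ?F" "g \<in> auto ?F" for f g
    using that group.subgroup_self[OF A] subgroup.m_closed[of _ "AutoGroup ?F"] by fastforce
  have "\<exists>\<rho>\<in>hom (braid_group n) (AutoGroup ?F). \<forall>k\<in>{1..<n}. \<rho> (braid_gen n k) = s k"
  proof (rule braid_group_universal[OF A])
    fix i j assume "1 \<le> i" "i + 2 \<le> j" "j < n"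
    then have [simp]: "i \<in> {1..<n}" "j \<in> {1..<n}" "i \<in> {1..n}" "j \<in> {1..n}"
      "i + 1 \<in> {1..n}" "j + 1 \<in> {1..n}" "j \<noteq> i" "j \<noteq> i + 1" "i \<noteq> j + 1" "j + 1 \<noteq> i" "i \<noteq> j" "i + 1 \<noteq> j" by auto
    show "s i \<otimes>\<^bsub>AutoGroup ?F\<^esub> s j = s j \<otimes>\<^bsub>AutoGroup ?F\<^esub> s i"
      by (rule auto_free_group_eqI[where S = "{1..n}"])
        (simp_all add: mult_auto rules del: One_nat_def add_Suc_right atLeastAtMost_iff atLeastLessThan_iff)
  next
    fix i assume "1 \<le> i" "i + 1 < n"
    then have [simp]: "i \<in> {1..<n}" "i + 1 \<in> {1..<n}" "i \<in> {1..n}"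
      "i + 1 \<in> {1..n}" "i + 1 + 1 \<in> {1..n}" by auto
    \<comment> \<open>On \<open>x_i\<close> the two sides are
      \<open>U (U x_i x_(i+1)) (U x_i x_(i+2))\<close> and \<open>U x_i (U x_(i+1) x_(i+2))\<close>,
      equal by \<open>U_distrib\<close>. On the other basis elements they agree without it.\<close>
    show "s i \<otimes>\<^bsub>AutoGroup ?F\<^esub> s (i + 1) \<otimes>\<^bsub>AutoGroup ?F\<^esub> s i =
        s (i + 1) \<otimes>\<^bsub>AutoGroup ?F\<^esub> s i \<otimes>\<^bsub>AutoGroup ?F\<^esub> s (i + 1)"
      by (rule auto_free_group_eqI[where S = "{1..n}"])
        (simp_all add: mult_auto rules U_distrib del: One_nat_def add_Suc_right atLeastAtMost_iff atLeastLessThan_iff)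
  qed (simp del: One_nat_def atLeastLessThan_iff)
  then obtain \<rho> where \<rho>: "\<rho> \<in> hom (braid_group n) (AutoGroup ?F)"
    "\<And>k. k \<in> {1..<n} \<Longrightarrow> \<rho> (braid_gen n k) = s k" by blast
  have "is_local_rep n U (\<lambda>a b. a) (restrict \<rho> (carrier (braid_group n)))"
    unfolding is_local_rep_def
  proof (intro conjI ballI)
    show "restrict \<rho> (carrier (braid_group n)) \<in> hom (braid_group n) (AutoGroup ?F)"
      using \<rho>(1) group.is_monoid[OF group_braid_group] by (auto simp: hom_def Pi_iff monoid.m_closed)
  qed (auto simp: \<rho>(2) s_gen simp del: One_nat_def)
  then show ?thesis by blast
qed

end

text \<open>Otherwise \<open>{1..n}\<close> is rewritten to \<open>{Suc 0..n}\<close>, and facts about \<open>free_rank n\<close> no longer match.\<close>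
declare One_nat_def [simp del]

section \<open>The representations of types (1) and (2)\<close>

lemma free_rack_wada1:
  "free_rack n
     (\<lambda>a b. a [^]\<^bsub>free_rank n\<^esub> (- h) \<otimes>\<^bsub>free_rank n\<^esub> b \<otimes>\<^bsub>free_rank n\<^esub> a [^]\<^bsub>free_rank n\<^esub> (h::int))
     (\<lambda>a b. a [^]\<^bsub>free_rank n\<^esub> h \<otimes>\<^bsub>free_rank n\<^esub> b \<otimes>\<^bsub>free_rank n\<^esub> a [^]\<^bsub>free_rank n\<^esub> (- h))"
proof -
  interpret group "free_rank n" by (rule group_free_group)
  show ?thesis
    by unfold_locales
      (auto simp: int_pow_neg m_assoc mult_inv_cancel inv_mult_cancel hom_mult hom_in_carrier[of _ "free_rank n"]
        hom_int_pow[OF _ _ group_free_group group_free_group] inv_mult_group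
        group_hom.hom_inv[OF group_homI[OF group_free_group group_free_group]]
        int_pow_conjugate)
qed

text \<open>This is the core operation of a group. It is involutive in its second argument, so it
  serves as its own \<open>U'\<close>; both sides of distributivity reduce to
  \<open>a b^-1 c b^-1 a\<close>.\<close>

lemma free_rack_wada2:
  "free_rack n
     (\<lambda>a b. a \<otimes>\<^bsub>free_rank n\<^esub> inv\<^bsub>free_rank n\<^esub> b \<otimes>\<^bsub>free_rank n\<^esub> a)
     (\<lambda>a b. a \<otimes>\<^bsub>free_rank n\<^esub> inv\<^bsub>free_rank n\<^esub> b \<otimes>\<^bsub>free_rank n\<^esub> a)"
proof -
  interpret group "free_rank n" by (rule group_free_group)
  show ?thesis
    by unfold_locales
      (auto simp: m_assoc mult_inv_cancel inv_mult_cancel hom_mult hom_in_carrier[of _ "free_rank n"] inv_mult_group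
        group_hom.hom_inv[OF group_homI[OF group_free_group group_free_group]])
qed

lemma is_local_rep_wada1:
  "is_local_rep n
     (\<lambda>a b. a [^]\<^bsub>free_rank n\<^esub> (- h) \<otimes>\<^bsub>free_rank n\<^esub> b \<otimes>\<^bsub>free_rank n\<^esub> a [^]\<^bsub>free_rank n\<^esub> h)
     (\<lambda>a b. a) (wada1 n h)" (is "is_local_rep n ?U _ _")
proof -
  obtain \<rho> where \<rho>: "is_local_rep n ?U (\<lambda>a b. a) \<rho>"
    using free_rack.local_rep_exists[OF free_rack_wada1] by (rule exE)
  show ?thesis using \<rho> unfolding wada1_def local_rep_eqI[OF \<rho>] .
qed

lemma is_local_rep_wada2:
  "is_local_rep n (\<lambda>a b. a \<otimes>\<^bsub>free_rank n\<^esub> inv\<^bsub>free_rank n\<^esub> b \<otimes>\<^bsub>free_rank n\<^esub> a) (\<lambda>a b. a) (wada2 n)" (is "is_local_rep n ?U _ _")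
proof -
  obtain \<rho> where \<rho>: "is_local_rep n ?U (\<lambda>a b. a) \<rho>"
    using free_rack.local_rep_exists[OF free_rack_wada2] by (rule exE)
  show ?thesis using \<rho> unfolding wada2_def local_rep_eqI[OF \<rho>] .
qed

text \<open>Conjugating \<open>\<rho>\<close> by \<open>\<phi>\<close> gives a homomorphism with the
  local values \<open>U\<close>, \<open>V\<close>, so it is \<open>local_rep n U V\<close> by
  uniqueness. Existence of the target thus comes for free, and the identity serves as braid
  automorphism. The hypotheses are written as intertwining relations so that the inverse of
  \<open>\<phi>\<close> need not be evaluated.\<close>

lemma rep_equivalent_local_rep:
  assumes \<rho>: "\<rho> \<in> hom (braid_group n) (AutoGroup (free_rank n))" and \<phi>: "\<phi> \<in> auto (free_rank n)"
    and closed: "\<And>k. k \<in> {1..<n} \<Longrightarrow> U (basis n k) (basis n (k + 1)) \<in> carrier (free_rank n)"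
      "\<And>k. k \<in> {1..<n} \<Longrightarrow> V (basis n k) (basis n (k + 1)) \<in> carrier (free_rank n)"
    and U: "\<And>k. k \<in> {1..<n} \<Longrightarrow>
      \<rho> (braid_gen n k) (\<phi> (basis n k)) = \<phi> (U (basis n k) (basis n (k + 1)))"
    and V: "\<And>k. k \<in> {1..<n} \<Longrightarrow>
      \<rho> (braid_gen n k) (\<phi> (basis n (k + 1))) = \<phi> (V (basis n k) (basis n (k + 1)))"
    and other: "\<And>k i. k \<in> {1..<n} \<Longrightarrow> i \<in> {1..n} - {k, k + 1} \<Longrightarrow>
      \<rho> (braid_gen n k) (\<phi> (basis n i)) = \<phi> (basis n i)"
  shows "rep_equivalent (braid_group n) (free_rank n) \<rho> (local_rep n U V)"
proof -
  let ?B = "braid_group n" and ?A = "AutoGroup (free_rank n)"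
  interpret B: group ?B by (rule group_braid_group)
  interpret A: group ?A by (rule group_AutoGroup_free_rank)
  interpret \<rho>: group_hom ?B ?A \<rho> using \<rho> by (intro group_homI B.is_group A.is_group)
  define \<rho>' where "\<rho>' = (\<lambda>\<beta>\<in>carrier ?B. inv\<^bsub>?A\<^esub> \<phi> \<otimes>\<^bsub>?A\<^esub> \<rho> \<beta> \<otimes>\<^bsub>?A\<^esub> \<phi>)"
  have \<phi>A [simp]: "\<phi> \<in> carrier ?A" using \<phi> by simp
  have hom: "\<rho>' \<in> hom ?B ?A"
    by (auto intro!: homI simp del: carrier_AutoGroup
        simp: \<rho>'_def A.m_assoc A.mult_inv_cancel)
  have \<phi>': "inv\<^bsub>?A\<^esub> \<phi> \<in> auto (free_rank n)" using A.inv_closed[OF \<phi>A] by simp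
  have cancel: "(inv\<^bsub>?A\<^esub> \<phi>) (\<phi> x) = x" if "x \<in> carrier (free_rank n)" for x
    using mult_AutoGroup_apply[OF \<phi>' \<phi> that] A.l_inv[OF \<phi>A] that by simp
  have conj: "\<rho>' \<beta> x = y" if "\<beta> \<in> carrier ?B" "x \<in> carrier (free_rank n)" "y \<in> carrier (free_rank n)"
    "\<rho> \<beta> (\<phi> x) = \<phi> y" for \<beta> x y
  proof -
    have "\<rho> \<beta> \<in> auto (free_rank n)" using \<rho>.hom_closed[OF that(1)] by simp
    moreover have "inv\<^bsub>?A\<^esub> \<phi> \<otimes>\<^bsub>?A\<^esub> \<rho> \<beta> \<in> auto (free_rank n)"
      using A.m_closed[OF A.inv_closed[OF \<phi>A] \<rho>.hom_closed[OF that(1)]] by simp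
    ultimately show ?thesis
      using that \<phi> \<phi>' by (simp add: \<rho>'_def mult_AutoGroup_apply auto_closed cancel)
  qed
  have "is_local_rep n U V \<rho>'"
    unfolding is_local_rep_def
  proof (intro conjI ballI hom)
    fix k assume k: "k \<in> {1..<n}"
    have kk: "k \<in> {1..n}" "k + 1 \<in> {1..n}" using k by auto
    show "\<rho>' (braid_gen n k) (basis n k) = U (basis n k) (basis n (k + 1))"
      by (rule conj[OF braid_gen_closed[OF k] free_gen_closed[OF kk(1)] closed(1)[OF k] U[OF k]])
    show "\<rho>' (braid_gen n k) (basis n (k + 1)) = V (basis n k) (basis n (k + 1))"
      by (rule conj[OF braid_gen_closed[OF k] free_gen_closed[OF kk(2)] closed(2)[OF k] V[OF k]])
    fix i assume "i \<in> {1..n} - {k, k + 1}"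
    then show "\<rho>' (braid_gen n k) (basis n i) = basis n i"
      using k other by (intro conj) auto
  qed (simp add: \<rho>'_def)
  then have "local_rep n U V = \<rho>'" by (rule local_rep_eqI)
  moreover have "(\<lambda>\<beta>\<in>carrier ?B. \<beta>) \<in> auto ?B" by (rule B.id_in_auto)
  ultimately show ?thesis
    unfolding rep_equivalent_def using \<phi>
    by (intro bexI[of _ \<phi>] bexI[of _ "\<lambda>\<beta>\<in>carrier ?B. \<beta>"]) (simp_all add: \<rho>'_def)
qed

section \<open>Explicit equivalences by changes of basis\<close>

lemma group_hom_braid_gen:
  assumes "\<rho> \<in> hom (braid_group n) (AutoGroup (free_rank n))" "\<beta> \<in> carrier (braid_group n)"
  shows "group_hom (free_rank n) (free_rank n) (\<rho> \<beta>)"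
  using hom_in_carrier[OF assms] by (intro group_homI group_free_group) (simp add: autoD(1))

lemma rep_equivalent_refl_wada1: "rep_equivalent (braid_group n) (free_rank n) (wada1 n h) (wada1 n h)"
proof -
  interpret F: group "free_rank n" by (rule group_free_group)
  note gen = is_local_repD(3)[OF is_local_rep_wada1[of n h]]
  show ?thesis
    by (subst (2) wada1_def)
      (rule rep_equivalent_local_rep[OF is_local_repD(2)[OF is_local_rep_wada1] F.id_in_auto],
        auto simp: gen)
qed

lemma rep_equivalent_wada1_uminus:
  "rep_equivalent (braid_group n) (free_rank n) (wada1 n h) (wada1 n (- h))"
proof -
  let ?F = "free_rank n"
  interpret F: group ?F by (rule group_free_group)
  note gen = is_local_repD(3)[OF is_local_rep_wada1[of n h]]
  define f where "f = free_lift {1..n} ?F (\<lambda>i. inv\<^bsub>?F\<^esub> basis n i)"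
  have f_hom: "f \<in> hom ?F ?F" unfolding f_def by (rule free_lift_hom[OF F.is_group]) simp
  interpret f: group_hom ?F ?F f by (rule group_homI[OF F.is_group F.is_group f_hom])
  have f_gen [simp]: "f (basis n i) = inv\<^bsub>?F\<^esub> basis n i" if "i \<in> {1..n}" for i
    unfolding f_def by (rule free_lift_gen[OF F.is_group _ that]) simp
  have ff: "f (f x) = x" if "x \<in> carrier ?F" for x
    by (rule free_group_hom_eq_id[OF hom_comp[OF f_hom f_hom] _ that]) simp
  have "restrict f (carrier ?F) \<in> auto ?F"
    by (rule restrict_autoI[OF F.is_group f_hom f_hom ff ff])
  then show ?thesis
    unfolding wada1_def[of n "- h"]
  proof (rule rep_equivalent_local_rep[OF is_local_repD(2)[OF is_local_rep_wada1]])
    fix k assume k: "k \<in> {1..<n}"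
    have [simp]: "k \<in> {1..n}" "k + 1 \<in> {1..n}" using k by auto
    interpret s: group_hom ?F ?F "wada1 n h (braid_gen n k)"
      by (rule group_hom_braid_gen[OF is_local_repD(2)[OF is_local_rep_wada1] braid_gen_closed[OF k]])
    show "wada1 n h (braid_gen n k) (restrict f (carrier ?F) (basis n k)) =
        restrict f (carrier ?F) (basis n k [^]\<^bsub>?F\<^esub> - (- h) \<otimes>\<^bsub>?F\<^esub> basis n (k + 1) \<otimes>\<^bsub>?F\<^esub> basis n k [^]\<^bsub>?F\<^esub> - h)"
      by (simp add: gen k F.int_pow_neg F.int_pow_inv F.inv_mult_group F.m_assoc f.hom_int_pow
        del: atLeastAtMost_iff atLeastLessThan_iff)
    show "wada1 n h (braid_gen n k) (restrict f (carrier ?F) (basis n (k + 1))) =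
        restrict f (carrier ?F) (basis n k)"
      by (simp add: gen k del: atLeastAtMost_iff atLeastLessThan_iff)
    show "wada1 n h (braid_gen n k) (restrict f (carrier ?F) (basis n i)) =
        restrict f (carrier ?F) (basis n i)" if "i \<in> {1..n} - {k, k + 1}" for i
      using that by (simp add: gen k del: atLeastAtMost_iff atLeastLessThan_iff)
  qed auto
qed

text \<open>
  With \<open>y\<^sub>i = x\<^sub>i\<close> for odd \<open>i\<close> and \<open>y\<^sub>i = x\<^sub>i\<^sup>-\<^sup>1\<close> for even \<open>i\<close>, type (2) reads
  \<open>y\<^sub>k \<mapsto> y\<^sub>k y\<^sub>k\<^sub>+\<^sub>1 y\<^sub>k\<close>, \<open>y\<^sub>k\<^sub>+\<^sub>1 \<mapsto> y\<^sub>k\<^sup>-\<^sup>1\<close>. It fixes \<open>y\<^sub>k\<^sup>-\<^sup>1 y\<^sub>k\<^sub>+\<^sub>1\<^sup>-\<^sup>1\<close>, hence all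
  \<open>u\<^sub>i = y\<^sub>1\<^sup>-\<^sup>1 \<dots> y\<^sub>i\<^sub>-\<^sub>1\<^sup>-\<^sup>1\<close> with \<open>i \<noteq> k + 1\<close>, and the elements \<open>u\<^sub>i y\<^sub>i u\<^sub>i\<^sup>-\<^sup>1\<close> transform as in type (3).
\<close>

definition (in group) alternate :: "nat \<Rightarrow> 'a \<Rightarrow> 'a" where
  "alternate i a = (if odd i then a else inv a)"

context group
begin

lemma alternate_closed [simp]: "a \<in> carrier G \<Longrightarrow> alternate i a \<in> carrier G"
  by (simp add: alternate_def)

lemma alternate_alternate [simp]: "a \<in> carrier G \<Longrightarrow> alternate i (alternate i a) = a"
  by (simp add: alternate_def)

lemma hom_alternate: "f \<in> hom G G \<Longrightarrow> a \<in> carrier G \<Longrightarrow> f (alternate i a) = alternate i (f a)"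
  using group_hom.hom_inv[OF group_homI[OF is_group is_group]] by (simp add: alternate_def)

primrec prefix :: "(nat \<Rightarrow> 'a) \<Rightarrow> nat \<Rightarrow> 'a" where
  "prefix y 0 = \<one>"
| "prefix y (Suc i) = (if i = 0 then \<one> else prefix y i \<otimes> inv (y i))"

text \<open>With \<open>y\<close> the basis itself, this is the preimage of \<open>prefix\<close>
  under the change of basis. The factors accumulate on the left here: the new generator is
  \<open>y i\<close> conjugated by the prefix, so multiplying by its inverse on the left appends
  \<open>inv (y i)\<close> on the right. The test \<open>i = 0\<close> skips index 0, which is not a
  basis index.\<close>

primrec suffix :: "(nat \<Rightarrow> 'a) \<Rightarrow> nat \<Rightarrow> 'a" where
  "suffix y 0 = \<one>"
| "suffix y (Suc i) = (if i = 0 then \<one> else inv (y i) \<otimes> suffix y i)"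

lemma prefix_closed: "(\<And>j. 1 \<le> j \<Longrightarrow> j < i \<Longrightarrow> y j \<in> carrier G) \<Longrightarrow> prefix y i \<in> carrier G"
  by (induction i) auto

lemma suffix_closed: "(\<And>j. 1 \<le> j \<Longrightarrow> j < i \<Longrightarrow> y j \<in> carrier G) \<Longrightarrow> suffix y i \<in> carrier G"
  by (induction i) auto

end

lemma rep_equivalent_wada2_wada3: "rep_equivalent (braid_group n) (free_rank n) (wada2 n) (wada3 n)"
proof -
  let ?F = "free_rank n"
  interpret F: group ?F by (rule group_free_group)
  note simps = F.m_assoc F.mult_inv_cancel F.inv_mult_cancel F.inv_mult_group
  note gen = is_local_repD(3)[OF is_local_rep_wada2[of n]]
  define y where "y i = F.alternate i (basis n i)" for i
  define u where "u = F.prefix y"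
  define v where "v = F.suffix (basis n)"
  define f where "f = free_lift {1..n} ?F (\<lambda>i. u i \<otimes>\<^bsub>?F\<^esub> y i \<otimes>\<^bsub>?F\<^esub> inv\<^bsub>?F\<^esub> u i)"
  \<comment> \<open>The inverse of \<open>f\<close>, read off from \<open>f (v i) = u i\<close>:
    since \<open>f (basis n i)\<close> is \<open>u i\<close> times \<open>y i\<close> times the
    inverse of \<open>u i\<close>, undoing the conjugation shows \<open>y i\<close> to be the image
    of \<open>basis n i\<close> conjugated by \<open>v i\<close>.\<close>
  define g where "g = free_lift {1..n} ?F
    (\<lambda>i. F.alternate i (inv\<^bsub>?F\<^esub> v i \<otimes>\<^bsub>?F\<^esub> basis n i \<otimes>\<^bsub>?F\<^esub> v i))"
  have y [simp]: "y i \<in> carrier ?F" if "i \<in> {1..n}" for i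
    using that by (simp add: y_def del: atLeastAtMost_iff)
  have u [simp]: "u i \<in> carrier ?F" if "i \<in> {1..n}" for i
    unfolding u_def using that by (intro F.prefix_closed y) auto
  have v [simp]: "v i \<in> carrier ?F" if "i \<in> {1..n}" for i
    unfolding v_def using that by (intro F.suffix_closed free_gen_closed) auto
  have u_1: "u 1 = \<one>\<^bsub>?F\<^esub>" and v_1: "v 1 = \<one>\<^bsub>?F\<^esub>"
    using F.prefix.simps(2)[of y 0] F.suffix.simps(2)[of "basis n" 0]
    by (simp_all add: u_def v_def flip: One_nat_def)
  have u_Suc: "u (Suc i) = u i \<otimes>\<^bsub>?F\<^esub> inv\<^bsub>?F\<^esub> y i"
    and v_Suc: "v (Suc i) = inv\<^bsub>?F\<^esub> basis n i \<otimes>\<^bsub>?F\<^esub> v i" if "i \<ge> 1" for i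
    using that by (simp_all add: u_def v_def)
  have f_hom: "f \<in> hom ?F ?F" unfolding f_def
    by (rule free_lift_hom[OF F.is_group]) (simp del: atLeastAtMost_iff)
  have g_hom: "g \<in> hom ?F ?F" unfolding g_def
    by (rule free_lift_hom[OF F.is_group]) (simp del: atLeastAtMost_iff)
  interpret f: group_hom ?F ?F f by (rule group_homI[OF F.is_group F.is_group f_hom])
  interpret g: group_hom ?F ?F g by (rule group_homI[OF F.is_group F.is_group g_hom])
  have f_gen: "f (basis n i) = u i \<otimes>\<^bsub>?F\<^esub> y i \<otimes>\<^bsub>?F\<^esub> inv\<^bsub>?F\<^esub> u i" if "i \<in> {1..n}" for i
    unfolding f_def by (rule free_lift_gen[OF F.is_group _ that]) (simp del: atLeastAtMost_iff)
  have g_gen: "g (basis n i) = F.alternate i (inv\<^bsub>?F\<^esub> v i \<otimes>\<^bsub>?F\<^esub> basis n i \<otimes>\<^bsub>?F\<^esub> v i)"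
    if "i \<in> {1..n}" for i
    unfolding g_def by (rule free_lift_gen[OF F.is_group _ that]) (simp del: atLeastAtMost_iff)
  have g_y: "g (y i) = inv\<^bsub>?F\<^esub> v i \<otimes>\<^bsub>?F\<^esub> basis n i \<otimes>\<^bsub>?F\<^esub> v i" if "i \<in> {1..n}" for i
    using that by (simp add: y_def F.hom_alternate[OF g_hom] g_gen del: atLeastAtMost_iff)
  have f_v: "f (v i) = u i" and g_u: "g (u i) = v i" if "1 \<le> i" "i \<le> n" for i
  proof -
    have "f (v i) = u i \<and> g (u i) = v i" using that
    proof (induction i rule: dec_induct)
      case base
      show ?case by (simp add: u_1 v_1)
    next
      case (step i)
      then have [simp]: "i \<in> {1..n}" by auto
      show ?case using step
        by (simp add: u_Suc v_Suc f_gen g_y simps del: atLeastAtMost_iff)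
    qed
    then show "f (v i) = u i" "g (u i) = v i" by auto
  qed
  have "restrict f (carrier ?F) \<in> auto ?F"
  proof (rule restrict_autoI[OF F.is_group f_hom g_hom])
    fix x assume x: "x \<in> carrier ?F"
    show "f (g x) = x"
    proof (rule free_group_hom_eq_id[OF hom_comp[OF g_hom f_hom] _ x])
      fix i assume i: "i \<in> {1..n}"
      have "inv\<^bsub>?F\<^esub> u i \<otimes>\<^bsub>?F\<^esub> (u i \<otimes>\<^bsub>?F\<^esub> y i \<otimes>\<^bsub>?F\<^esub> inv\<^bsub>?F\<^esub> u i) \<otimes>\<^bsub>?F\<^esub> u i = y i"
        using i by (simp add: simps del: atLeastAtMost_iff)
      then show "f (g (basis n i)) = basis n i"
        using i f_v[of i] by (simp add: g_gen F.hom_alternate[OF f_hom] f_gen del: atLeastAtMost_iff)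
          (simp add: y_def)
    qed
    show "g (f x) = x"
    proof (rule free_group_hom_eq_id[OF hom_comp[OF f_hom g_hom] _ x])
      fix i assume i: "i \<in> {1..n}"
      then have "g (u i) = v i" using g_u by simp
      then show "g (f (basis n i)) = basis n i"
        using i by (simp add: f_gen g_y simps del: atLeastAtMost_iff)
    qed
  qed
  then show ?thesis
    unfolding wada3_def
  proof (rule rep_equivalent_local_rep[OF is_local_repD(2)[OF is_local_rep_wada2]])
    fix k assume k: "k \<in> {1..<n}"
    have [simp]: "k \<in> {1..n}" "k + 1 \<in> {1..n}" using k by auto
    let ?s = "wada2 n (braid_gen n k)"
    interpret s: group_hom ?F ?F ?s
      by (rule group_hom_braid_gen[OF is_local_repD(2)[OF is_local_rep_wada2] braid_gen_closed[OF k]])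
    have s_y: "?s (y i) = (if i = k then y k \<otimes>\<^bsub>?F\<^esub> y (k + 1) \<otimes>\<^bsub>?F\<^esub> y k
        else if i = k + 1 then inv\<^bsub>?F\<^esub> y k else y i)" if "i \<in> {1..n}" for i
      using that k unfolding y_def F.hom_alternate[OF s.homh free_gen_closed[OF that]]
      by (auto simp: gen F.alternate_def simps simp del: atLeastAtMost_iff atLeastLessThan_iff)
    have s_u: "?s (u i) = u i" if "1 \<le> i" "i \<le> k" for i
      using that
    proof (induction i rule: dec_induct)
      case base
      show ?case by (simp add: u_1)
    next
      case (step i)
      then have [simp]: "i \<in> {1..n}" "i \<noteq> k" "i \<noteq> k + 1" using k by auto
      show ?case using step by (simp add: u_Suc s_y del: atLeastAtMost_iff)
    qed
    have u_k1: "u (k + 1) = u k \<otimes>\<^bsub>?F\<^esub> inv\<^bsub>?F\<^esub> y k" using k u_Suc[of k] by (simp add: Suc_eq_plus1)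
    have s_uk: "?s (u k) = u k" using s_u k by simp
    have s_u': "?s (u i) = u i" if "k + 2 \<le> i" "i \<le> n" for i
      using that
    proof (induction i rule: dec_induct)
      case base
      then have "u (k + 2) = u k \<otimes>\<^bsub>?F\<^esub> inv\<^bsub>?F\<^esub> y k \<otimes>\<^bsub>?F\<^esub> inv\<^bsub>?F\<^esub> y (k + 1)"
        using u_Suc[OF le_add2[of 1 k]] u_k1 by (simp add: numeral_2_eq_2 One_nat_def)
      then show ?case by (simp add: s_uk s_y simps del: atLeastAtMost_iff add_2_eq_Suc')
    next
      case (step i)
      then have [simp]: "i \<in> {1..n}" "i \<noteq> k" "i \<noteq> k + 1" "i \<ge> 1" using k by auto
      show ?case using step by (simp add: u_Suc s_y del: atLeastAtMost_iff)
    qed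
    have sq: "a [^]\<^bsub>?F\<^esub> (2::nat) = a \<otimes>\<^bsub>?F\<^esub> a" if "a \<in> carrier ?F" for a
      using that by (simp add: numeral_2_eq_2)
    show "?s (restrict f (carrier ?F) (basis n k)) =
        restrict f (carrier ?F) (basis n k [^]\<^bsub>?F\<^esub> (2::nat) \<otimes>\<^bsub>?F\<^esub> basis n (k + 1))"
      by (simp add: sq f_gen s_uk s_y u_k1 simps del: atLeastAtMost_iff)
    show "?s (restrict f (carrier ?F) (basis n (k + 1))) =
        restrict f (carrier ?F) (inv\<^bsub>?F\<^esub> basis n (k + 1) \<otimes>\<^bsub>?F\<^esub> inv\<^bsub>?F\<^esub> basis n k \<otimes>\<^bsub>?F\<^esub> basis n (k + 1))"
      by (simp add: f_gen s_uk s_y u_k1 simps del: atLeastAtMost_iff)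
    show "?s (restrict f (carrier ?F) (basis n i)) = restrict f (carrier ?F) (basis n i)"
      if "i \<in> {1..n} - {k, k + 1}" for i
    proof -
      have [simp]: "i \<in> {1..n}" "i \<noteq> k" "i \<noteq> k + 1" using that by auto
      have "?s (u i) = u i"
      proof (cases "i \<le> k")
        case False
        then have "k + 2 \<le> i" using \<open>i \<noteq> k + 1\<close> by linarith
        then show ?thesis using s_u'[of i] that by simp
      qed (use s_u[of i] that in simp)
      then show ?thesis by (simp add: f_gen s_y del: atLeastAtMost_iff)
    qed
  qed auto
qed

section \<open>Free products of two cyclic groups\<close>

text \<open>
  The free product of two cyclic groups of order \<open>H\<close>, acting on its reduced words from the left:
  \<open>rotate_head H i d\<close> is multiplication by the \<open>d\<close>-th power of the generator \<open>i\<close>.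
\<close>

fun reduced :: "int \<Rightarrow> (bool \<times> int) list \<Rightarrow> bool" where
  "reduced H [] \<longleftrightarrow> True"
| "reduced H (a # r) \<longleftrightarrow> 0 < snd a \<and> snd a < H \<and> (r \<noteq> [] \<longrightarrow> fst (hd r) \<noteq> fst a) \<and> reduced H r"

definition starts_with :: "bool \<Rightarrow> (bool \<times> int) list \<Rightarrow> bool" where
  "starts_with i r \<longleftrightarrow> r \<noteq> [] \<and> fst (hd r) = i"

text \<open>The default 0 lets \<open>head_exp\<close> and \<open>strip\<close> split every reduced
  word into a possibly trivial power of \<open>i\<close> and a word not starting with
  \<open>i\<close>; \<open>push\<close> reassembles it.\<close>

definition head_exp :: "bool \<Rightarrow> (bool \<times> int) list \<Rightarrow> int" where
  "head_exp i r = (if starts_with i r then snd (hd r) else 0)"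

definition strip :: "bool \<Rightarrow> (bool \<times> int) list \<Rightarrow> (bool \<times> int) list" where
  "strip i r = (if starts_with i r then tl r else r)"

definition push :: "int \<Rightarrow> bool \<Rightarrow> int \<Rightarrow> (bool \<times> int) list \<Rightarrow> (bool \<times> int) list" where
  "push H i e r = (if e mod H = 0 then r else (i, e mod H) # r)"

definition rotate_head :: "int \<Rightarrow> bool \<Rightarrow> int \<Rightarrow> (bool \<times> int) list \<Rightarrow> (bool \<times> int) list" where
  "rotate_head H i d r = push H i (head_exp i r + d) (strip i r)"

text \<open>Modulo \<open>H\<close>, this is the homomorphism from the free product onto the cyclic
  group of order \<open>H\<close> that kills the generator \<open>True\<close>.\<close>

definition weight :: "(bool \<times> int) list \<Rightarrow> int" where
  "weight r = sum_list (map (\<lambda>(i, e). if i then 0 else e) r)"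

lemma reduced_strip [simp]: "reduced H r \<Longrightarrow> reduced H (strip i r)"
  by (cases r) (auto simp: strip_def)

lemma not_starts_with_strip [simp]: "reduced H r \<Longrightarrow> \<not> starts_with i (strip i r)"
  by (cases r) (auto simp: strip_def starts_with_def)

lemma push_head_exp: "reduced H r \<Longrightarrow> H > 0 \<Longrightarrow> push H i (head_exp i r) (strip i r) = r"
  by (cases r) (auto simp: push_def head_exp_def strip_def starts_with_def)

lemma
  assumes "\<not> starts_with i r"
  shows head_exp_push: "head_exp i (push H i e r) = e mod H"
    and strip_push: "strip i (push H i e r) = r"
  using assms by (auto simp: push_def head_exp_def strip_def starts_with_def)

lemma reduced_push: "reduced H r \<Longrightarrow> \<not> starts_with i r \<Longrightarrow> H > 0 \<Longrightarrow> reduced H (push H i e r)"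
  using pos_mod_sign[of H e] pos_mod_bound[of H e]
  by (auto simp: push_def starts_with_def order.order_iff_strict simp del: pos_mod_sign)

lemma weight_push: "weight (push H i e r) = weight r + (if i then 0 else e mod H)"
  by (simp add: weight_def push_def)

lemma weight_strip: "weight r = weight (strip i r) + (if i then 0 else head_exp i r)"
  by (cases r) (auto simp: weight_def strip_def head_exp_def starts_with_def)

context
  fixes H :: int assumes H: "H > 0"
begin

lemma reduced_rotate_head: "reduced H r \<Longrightarrow> reduced H (rotate_head H i d r)"
  using H by (simp add: rotate_head_def reduced_push)

lemma rotate_head_add:
  "reduced H r \<Longrightarrow> rotate_head H i d (rotate_head H i e r) = rotate_head H i (d + e) r"
  by (simp add: rotate_head_def head_exp_push strip_push)
    (simp add: push_def mod_simps algebra_simps)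

lemma rotate_head_dvd: "reduced H r \<Longrightarrow> H dvd d \<Longrightarrow> rotate_head H i d r = r"
proof -
  assume "reduced H r" "H dvd d"
  then have "(head_exp i r + d) mod H = head_exp i r mod H" by (auto elim!: dvdE)
  then show ?thesis
    using push_head_exp[OF \<open>reduced H r\<close> H, of i] by (simp only: rotate_head_def push_def)
qed

lemma weight_rotate_head:
  "reduced H r \<Longrightarrow> H dvd weight (rotate_head H i d r) - weight r - (if i then 0 else d)"
  using weight_strip[of r i]
  by (auto simp: rotate_head_def weight_push mod_eq_dvd_iff[symmetric] mod_simps algebra_simps
    intro!: mod_eq_dvd_iff[THEN iffD1])

end

section \<open>The exchange of the two free factors\<close>

abbreviation flip_word :: "(bool \<times> int) list \<Rightarrow> (bool \<times> int) list" where
  "flip_word \<equiv> map (apfst Not)"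

lemma starts_with_flip_word: "starts_with i (flip_word r) \<longleftrightarrow> starts_with (\<not> i) r"
  by (cases r) (auto simp: starts_with_def)

lemma reduced_flip_word [simp]: "reduced H (flip_word r) \<longleftrightarrow> reduced H r"
  by (induction r rule: induct_list012) auto

lemma rotate_head_flip_word: "rotate_head H i d (flip_word r) = flip_word (rotate_head H (\<not> i) d r)"
  by (cases r) (auto simp: rotate_head_def push_def head_exp_def strip_def starts_with_def)

lemma apfst_Not_Not [simp]: "apfst Not \<circ> apfst Not = id"
  by auto

text \<open>Reduced words are normal forms, so invariance under the exchange is equality of lists,
  which already fails at the first syllable.\<close>

lemma flip_word_eq_self: "flip_word r = r \<Longrightarrow> r = []"
  by (cases r) auto

text \<open>Permuting normal forms, as in van der Waerden's argument, gives the relations of the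
  free product without defining a product of reduced words. The restriction is there because members
  of \<open>BijGroup\<close> are extensional.\<close>

definition word_rotation :: "int \<Rightarrow> bool \<Rightarrow> int \<Rightarrow> (bool \<times> int) list \<Rightarrow> (bool \<times> int) list" where
  "word_rotation H i d = restrict (rotate_head H i d) (Collect (reduced H))"

definition word_flip :: "int \<Rightarrow> (bool \<times> int) list \<Rightarrow> (bool \<times> int) list" where
  "word_flip H = restrict flip_word (Collect (reduced H))"

lemma carrier_BijGroup [simp]: "carrier (BijGroup S) = Bij S"
  by (simp add: BijGroup_def)

lemma one_BijGroup [simp]: "\<one>\<^bsub>BijGroup S\<^esub> = (\<lambda>x\<in>S. x)"
  by (simp add: BijGroup_def)

lemma mult_BijGroup_apply:
  "f \<in> Bij S \<Longrightarrow> g \<in> Bij S \<Longrightarrow> x \<in> S \<Longrightarrow> (f \<otimes>\<^bsub>BijGroup S\<^esub> g) x = f (g x)"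
  by (simp add: BijGroup_def compose_def)

lemma Bij_eqI: "f \<in> Bij S \<Longrightarrow> g \<in> Bij S \<Longrightarrow> (\<And>x. x \<in> S \<Longrightarrow> f x = g x) \<Longrightarrow> f = g"
  using Bij_imp_extensional extensionalityI by metis

lemma mult_Bij: "f \<in> Bij S \<Longrightarrow> g \<in> Bij S \<Longrightarrow> f \<otimes>\<^bsub>BijGroup S\<^esub> g \<in> Bij S"
  by (simp add: BijGroup_def compose_Bij)

lemma restrict_BijI:
  assumes "\<And>x. x \<in> S \<Longrightarrow> f x \<in> S" "\<And>x. x \<in> S \<Longrightarrow> g x \<in> S"
    and "\<And>x. x \<in> S \<Longrightarrow> g (f x) = x" "\<And>x. x \<in> S \<Longrightarrow> f (g x) = x"
  shows "restrict f S \<in> Bij S"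
  using assms bij_betwI[of f S S g] by (auto simp: Bij_def)

lemma word_flip_Bij [simp]: "word_flip H \<in> Bij (Collect (reduced H))"
  unfolding word_flip_def by (rule restrict_BijI[where g = flip_word]) auto

context
  fixes H :: int assumes H: "H > 0"
begin

lemma word_rotation_Bij [simp]: "word_rotation H i d \<in> Bij (Collect (reduced H))"
  unfolding word_rotation_def
  by (rule restrict_BijI[where g = "rotate_head H i (- d)"])
    (auto simp: reduced_rotate_head[OF H] rotate_head_add[OF H] rotate_head_dvd[OF H])

lemma word_rotation_add:
  "word_rotation H i d \<otimes>\<^bsub>BijGroup (Collect (reduced H))\<^esub> word_rotation H i e = word_rotation H i (d + e)"
  by (rule Bij_eqI[where S = "Collect (reduced H)"])
    (simp_all add: mult_Bij mult_BijGroup_apply, simp_all add: word_rotation_def reduced_rotate_head[OF H] rotate_head_add[OF H])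

lemma word_rotation_int_pow:
  "word_rotation H i 1 [^]\<^bsub>BijGroup (Collect (reduced H))\<^esub> z = word_rotation H i z" for z :: int
proof -
  have "word_rotation H i \<in> hom integer_group (BijGroup (Collect (reduced H)))"
    by (rule homI) (simp_all add: word_rotation_add)
  from hom_int_pow[OF this _ group_integer_group group_BijGroup, of 1 z] show ?thesis by simp
qed

lemma word_rotation_dvd: "H dvd d \<Longrightarrow> word_rotation H i d = \<one>\<^bsub>BijGroup (Collect (reduced H))\<^esub>"
  by (auto simp: word_rotation_def rotate_head_dvd[OF H] restrict_def fun_eq_iff)

lemma word_flip_mult_self: "word_flip H \<otimes>\<^bsub>BijGroup (Collect (reduced H))\<^esub> word_flip H =
    \<one>\<^bsub>BijGroup (Collect (reduced H))\<^esub>"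
  by (rule Bij_eqI[where S = "Collect (reduced H)"])
    (simp_all add: mult_Bij mult_BijGroup_apply id_Bij, simp_all add: word_flip_def)

lemma word_flip_rotation: "word_flip H \<otimes>\<^bsub>BijGroup (Collect (reduced H))\<^esub> word_rotation H i d =
    word_rotation H (\<not> i) d \<otimes>\<^bsub>BijGroup (Collect (reduced H))\<^esub> word_flip H"
  by (rule Bij_eqI[where S = "Collect (reduced H)"])
    (simp_all add: mult_Bij mult_BijGroup_apply,
      simp add: word_flip_def word_rotation_def reduced_rotate_head[OF H] rotate_head_flip_word)

end

section \<open>Exponent sums\<close>

definition expo :: "nat \<Rightarrow> nat \<Rightarrow> nat word set \<Rightarrow> int" where
  "expo n i = free_lift {1..n} integer_group (\<lambda>j. if j = i then 1 else 0)"

lemma expo_hom: "expo n i \<in> hom (free_rank n) integer_group"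
  unfolding expo_def by (rule free_lift_hom) simp_all

lemma expo_gen [simp]: "j \<in> {1..n} \<Longrightarrow> expo n i (basis n j) = (if j = i then 1 else 0)"
  unfolding expo_def by (subst free_lift_gen) simp_all

lemma
  assumes x: "x \<in> carrier (free_rank n)"
  shows expo_mult [simp]: "y \<in> carrier (free_rank n) \<Longrightarrow>
      expo n i (x \<otimes>\<^bsub>free_rank n\<^esub> y) = expo n i x + expo n i y"
    and expo_inv [simp]: "expo n i (inv\<^bsub>free_rank n\<^esub> x) = - expo n i x"
    and expo_int_pow [simp]: "expo n i (x [^]\<^bsub>free_rank n\<^esub> (z::int)) = z * expo n i x"
proof -
  interpret group_hom "free_rank n" integer_group "expo n i"
    by (rule group_homI[OF group_free_group group_integer_group expo_hom])
  show "y \<in> carrier (free_rank n) \<Longrightarrow> expo n i (x \<otimes>\<^bsub>free_rank n\<^esub> y) = expo n i x + expo n i y"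
    "expo n i (inv\<^bsub>free_rank n\<^esub> x) = - expo n i x"
    "expo n i (x [^]\<^bsub>free_rank n\<^esub> z) = z * expo n i x"
    using x by (simp_all add: hom_int_pow)
qed

lemma expo_one [simp]: "expo n i \<one>\<^bsub>free_rank n\<^esub> = 0"
  using group_hom.hom_one[OF group_homI[OF group_free_group group_integer_group expo_hom]] by simp

text \<open>Both sides are homomorphisms agreeing on the basis. This replaces the abelianization: it
  expresses exponent sums after any endomorphism by those before it.\<close>

lemma hom_integer_group_expo:
  assumes "g \<in> hom (free_rank n) integer_group" "x \<in> carrier (free_rank n)"
  shows "g x = (\<Sum>i\<in>{1..n}. g (basis n i) * expo n i x)"
proof (rule free_group_hom_eqI[OF group_integer_group assms(1) _ _ assms(2)])
  show "(\<lambda>x. \<Sum>i\<in>{1..n}. g (basis n i) * expo n i x) \<in> hom (free_rank n) integer_group"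
    by (rule homI) (simp_all add: sum.distrib distrib_left)
  fix j assume "j \<in> {1..n}"
  then show "g (basis n j) = (\<Sum>i\<in>{1..n}. g (basis n i) * expo n i (basis n j))"
    by (simp add: if_distrib cong: if_cong)
qed

lemma braid_rep_one: "\<rho> \<in> hom (braid_group n) (AutoGroup (free_rank n)) \<Longrightarrow>
    x \<in> carrier (free_rank n) \<Longrightarrow> \<rho> \<one>\<^bsub>braid_group n\<^esub> x = x"
  using group_hom.hom_one[OF group_homI[OF group_braid_group group_AutoGroup_free_rank]] by simp

lemma
  assumes \<rho>: "\<rho> \<in> hom (braid_group n) (AutoGroup (free_rank n))"
    and \<beta>: "\<beta> \<in> carrier (braid_group n)" and x: "x \<in> carrier (free_rank n)"
  shows braid_rep_closed: "\<rho> \<beta> x \<in> carrier (free_rank n)"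
    and braid_rep_mult: "\<gamma> \<in> carrier (braid_group n) \<Longrightarrow> \<rho> (\<beta> \<otimes>\<^bsub>braid_group n\<^esub> \<gamma>) x = \<rho> \<beta> (\<rho> \<gamma> x)"
    and braid_rep_inv: "\<rho> \<beta> (\<rho> (inv\<^bsub>braid_group n\<^esub> \<beta>) x) = x" "\<rho> (inv\<^bsub>braid_group n\<^esub> \<beta>) (\<rho> \<beta> x) = x"
proof -
  interpret B: group "braid_group n" by (rule group_braid_group)
  have auto: "\<rho> \<delta> \<in> auto (free_rank n)" if "\<delta> \<in> carrier (braid_group n)" for \<delta>
    using hom_in_carrier[OF \<rho> that] by simp
  then show "\<rho> \<beta> x \<in> carrier (free_rank n)" by (rule auto_closed[OF _ x]) (rule \<beta>)
  have mult: "\<rho> (\<delta> \<otimes>\<^bsub>braid_group n\<^esub> \<gamma>) x = \<rho> \<delta> (\<rho> \<gamma> x)"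
    if "\<delta> \<in> carrier (braid_group n)" "\<gamma> \<in> carrier (braid_group n)" for \<delta> \<gamma>
    using that by (simp add: hom_mult[OF \<rho>] mult_AutoGroup_apply[OF auto auto x])
  show "\<gamma> \<in> carrier (braid_group n) \<Longrightarrow> \<rho> (\<beta> \<otimes>\<^bsub>braid_group n\<^esub> \<gamma>) x = \<rho> \<beta> (\<rho> \<gamma> x)"
    by (rule mult[OF \<beta>])
  show "\<rho> \<beta> (\<rho> (inv\<^bsub>braid_group n\<^esub> \<beta>) x) = x" "\<rho> (inv\<^bsub>braid_group n\<^esub> \<beta>) (\<rho> \<beta> x) = x"
    using mult[OF \<beta> B.inv_closed[OF \<beta>]] mult[OF B.inv_closed[OF \<beta>] \<beta>] braid_rep_one[OF \<rho> x] \<beta>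
    by simp_all
qed

text \<open>In this form \<open>\<phi>\<close> visibly carries points fixed by
  \<open>\<rho>'\<close> to points fixed by \<open>\<rho>\<close>.\<close>

lemma rep_equivalentD:
  assumes "rep_equivalent (braid_group n) (free_rank n) \<rho> \<rho>'"
    and \<rho>: "\<rho> \<in> hom (braid_group n) (AutoGroup (free_rank n))"
  shows "\<exists>\<phi>\<in>auto (free_rank n). \<exists>\<mu>\<in>auto (braid_group n).
    \<forall>\<beta>\<in>carrier (braid_group n). \<forall>x\<in>carrier (free_rank n). \<phi> (\<rho>' (\<mu> \<beta>) x) = \<rho> \<beta> (\<phi> x)"
proof -
  let ?A = "AutoGroup (free_rank n)"
  interpret A: group ?A by (rule group_AutoGroup_free_rank)
  obtain \<phi> \<mu> where \<phi>: "\<phi> \<in> auto (free_rank n)" and \<mu>: "\<mu> \<in> auto (braid_group n)"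
    and eq: "\<And>\<beta>. \<beta> \<in> carrier (braid_group n) \<Longrightarrow>
      \<rho>' (\<mu> \<beta>) = inv\<^bsub>?A\<^esub> \<phi> \<otimes>\<^bsub>?A\<^esub> \<rho> \<beta> \<otimes>\<^bsub>?A\<^esub> \<phi>"
    using assms(1) unfolding rep_equivalent_def by blast
  have "\<phi> (\<rho>' (\<mu> \<beta>) x) = \<rho> \<beta> (\<phi> x)"
    if \<beta>: "\<beta> \<in> carrier (braid_group n)" and x: "x \<in> carrier (free_rank n)" for \<beta> x
  proof -
    have \<rho>\<beta>: "\<rho> \<beta> \<in> carrier ?A" using hom_in_carrier[OF \<rho> \<beta>] .
    have \<phi>A: "\<phi> \<in> carrier ?A" using \<phi> by simp
    have "\<phi> \<otimes>\<^bsub>?A\<^esub> \<rho>' (\<mu> \<beta>) = \<rho> \<beta> \<otimes>\<^bsub>?A\<^esub> \<phi>"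
      unfolding eq[OF \<beta>] using \<rho>\<beta> \<phi>A by (simp add: A.m_assoc A.mult_inv_cancel del: carrier_AutoGroup)
    moreover have "\<rho>' (\<mu> \<beta>) \<in> carrier ?A"
      unfolding eq[OF \<beta>] using \<rho>\<beta> \<phi>A by (simp del: carrier_AutoGroup)
    ultimately show ?thesis
      using \<rho>\<beta> \<phi> x mult_AutoGroup_apply[OF \<phi> _ x, of "\<rho>' (\<mu> \<beta>)"] mult_AutoGroup_apply[OF _ \<phi> x, of "\<rho> \<beta>"]
      by simp
  qed
  then show ?thesis by (intro bexI[OF _ \<phi>] bexI[OF _ \<mu>] ballI)
qed

section \<open>Fixed points of the type (1) representations\<close>

definition fixed_points :: "nat \<Rightarrow> (nat word set set \<Rightarrow> nat word set \<Rightarrow> nat word set) \<Rightarrow> nat word set set" where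
  "fixed_points n \<rho> = {x \<in> carrier (free_rank n). \<forall>\<beta>\<in>carrier (braid_group n). \<rho> \<beta> x = x}"

lemma fixed_pointsI:
  assumes \<rho>: "\<rho> \<in> hom (braid_group n) (AutoGroup (free_rank n))"
    and x: "x \<in> carrier (free_rank n)"
    and gen: "\<And>k. k \<in> {1..<n} \<Longrightarrow> \<rho> (braid_gen n k) x = x"
  shows "x \<in> fixed_points n \<rho>"
proof -
  have gens: "braid_gen n ` {1..<n} \<subseteq> carrier (braid_group n)" by auto
  note closed = group.generate_in_carrier[OF group_braid_group gens]
  have "\<rho> \<beta> x = x" if "\<beta> \<in> generate (braid_group n) (braid_gen n ` {1..<n})" for \<beta>
    using that
  proof (induction rule: generate.induct)
    case one
    show ?case by (rule braid_rep_one[OF \<rho> x])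
  next
    case (incl h)
    then show ?case using gen by blast
  next
    case (inv h)
    then have "\<rho> h x = x" "h \<in> carrier (braid_group n)" using gen gens by blast+
    then show ?case using braid_rep_inv(2)[OF \<rho> _ x, of h] by simp
  next
    case (eng h1 h2)
    then show ?case using braid_rep_mult[OF \<rho> closed x closed] by simp
  qed
  then show ?thesis using x by (simp add: fixed_points_def generate_braid_gen)
qed

primrec power_product :: "nat \<Rightarrow> int \<Rightarrow> nat \<Rightarrow> nat word set" where
  "power_product n h 0 = \<one>\<^bsub>free_rank n\<^esub>"
| "power_product n h (Suc m) =
    basis n (Suc m) [^]\<^bsub>free_rank n\<^esub> h \<otimes>\<^bsub>free_rank n\<^esub> power_product n h m"

lemma power_product_closed [simp]: "m \<le> n \<Longrightarrow> power_product n h m \<in> carrier (free_rank n)"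
  by (induction m)
    (auto intro!: monoid.m_closed monoid.one_closed group.int_pow_closed group.is_monoid group_free_group)

lemma expo_power_product: "m \<le> n \<Longrightarrow> expo n 1 (power_product n h m) = (if m = 0 then 0 else h)"
proof (induction m)
  case (Suc m)
  interpret F: group "free_rank n" by (rule group_free_group)
  have [simp]: "Suc m \<in> {1..n}" "Suc m = 1 \<longleftrightarrow> m = 0" using Suc by auto
  show ?case using Suc by (simp del: atLeastAtMost_iff)
qed simp

text \<open>The descending order matters: \<open>x_(k+1)^h x_k^h\<close> goes to
  \<open>x_k^h (x_k^-h x_(k+1)^h x_k^h)\<close>, which is the same element.\<close>

lemma power_product_fixed: "power_product n h n \<in> fixed_points n (wada1 n h)"
proof (rule fixed_pointsI[OF is_local_repD(2)[OF is_local_rep_wada1]])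
  let ?F = "free_rank n"
  interpret F: group ?F by (rule group_free_group)
  fix k assume k: "k \<in> {1..<n}"
  have kk [simp]: "k \<in> {1..n}" "k + 1 \<in> {1..n}" using k by auto
  let ?s = "wada1 n h (braid_gen n k)"
  interpret s: group_hom ?F ?F ?s
    by (rule group_hom_braid_gen[OF is_local_repD(2)[OF is_local_rep_wada1] braid_gen_closed[OF k]])
  note gen = is_local_repD(3)[OF is_local_rep_wada1[of n h] k]
  have below: "?s (power_product n h m) = power_product n h m" if "m < k" for m
    using that
  proof (induction m)
    case (Suc m)
    then have [simp]: "Suc m \<in> {1..n}" "Suc m \<noteq> k" "m \<noteq> k" "m \<le> n" using k by auto
    show ?case using Suc by (simp add: gen s.hom_int_pow del: atLeastAtMost_iff)
  qed simp
  \<comment> \<open>The partial product ending at \<open>k\<close> contains only one of the two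
    moved generators and is not preserved in general, so the induction starts at
    \<open>k + 1\<close>.\<close>
  have above: "?s (power_product n h m) = power_product n h m" if "k + 1 \<le> m" "m \<le> n" for m
    using that
  proof (induction m rule: dec_induct)
    case base
    obtain j where j: "k = Suc j" using k by (cases k) auto
    have [simp]: "power_product n h j \<in> carrier ?F" using j k by auto
    have "power_product n h (k + 1) =
        basis n (k + 1) [^]\<^bsub>?F\<^esub> h \<otimes>\<^bsub>?F\<^esub> (basis n k [^]\<^bsub>?F\<^esub> h \<otimes>\<^bsub>?F\<^esub> power_product n h j)"
      by (simp add: j flip: Suc_eq_plus1)
    moreover have "?s (power_product n h j) = power_product n h j" using below j by simp
    ultimately show ?case
      by (simp add: gen s.hom_int_pow F.int_pow_neg F.m_assoc F.mult_inv_cancel F.inv_mult_cancel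
          F.int_pow_conjugate del: atLeastAtMost_iff power_product.simps)
  next
    case (step m)
    then have [simp]: "Suc m \<in> {1..n}" "Suc m \<noteq> k" "m \<noteq> k" "m \<le> n" using k by auto
    show ?case using step by (simp add: gen s.hom_int_pow del: atLeastAtMost_iff)
  qed
  show "?s (power_product n h n) = power_product n h n" using above k by simp
qed simp

lemma expo_wada1_gen:
  assumes k: "k \<in> {1..<n}" and x: "x \<in> carrier (free_rank n)"
  shows "expo n i (wada1 n h (braid_gen n k) x) =
    expo n (if i = k then k + 1 else if i = k + 1 then k else i) x"
proof (rule free_group_hom_eqI[OF group_integer_group hom_comp[OF _ expo_hom] expo_hom _ x])
  interpret F: group "free_rank n" by (rule group_free_group)
  interpret s: group_hom "free_rank n" "free_rank n" "wada1 n h (braid_gen n k)"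
    by (rule group_hom_braid_gen[OF is_local_repD(2)[OF is_local_rep_wada1] braid_gen_closed[OF k]])
  show "wada1 n h (braid_gen n k) \<in> hom (free_rank n) (free_rank n)" by (rule s.homh)
  have kk [simp]: "k \<in> {1..n}" "k + 1 \<in> {1..n}" using k by auto
  fix j assume j: "j \<in> {1..n}"
  show "expo n i (wada1 n h (braid_gen n k) (basis n j)) =
      expo n (if i = k then k + 1 else if i = k + 1 then k else i) (basis n j)"
    using j by (auto simp: is_local_repD(3)[OF is_local_rep_wada1[of n h] k] simp del: atLeastAtMost_iff)
qed

text \<open>
  Killing the \<open>h\<close>-th powers of \<open>x\<^sub>k\<close>, \<open>x\<^sub>k\<^sub>+\<^sub>1\<close> and all other generators turns the action of \<open>\<sigma>\<^sub>k\<close> into the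
  exchange of the two free factors, which fixes only the identity.
\<close>

lemma dvd_expo_of_wada1_gen_fixed:
  assumes k: "k \<in> {1..<n}" and h: "h \<noteq> 0" and x: "x \<in> carrier (free_rank n)"
    and fixed: "wada1 n h (braid_gen n k) x = x"
  shows "h dvd expo n k x"
proof -
  let ?F = "free_rank n"
  \<comment> \<open>A positive modulus is needed for reduced words, while \<open>h\<close> and its
    absolute value generate the same subgroup of the integers.\<close>
  define H where "H = \<bar>h\<bar>"
  have H: "H > 0" and hH: "H dvd h" using h by (auto simp: H_def)
  let ?\<Omega> = "Collect (reduced H)"
  let ?B = "BijGroup ?\<Omega>"
  let ?s = "wada1 n h (braid_gen n k)"
  interpret F: group ?F by (rule group_free_group)
  interpret B: group ?B by (rule group_BijGroup)
  interpret s: group_hom ?F ?F ?s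
    by (rule group_hom_braid_gen[OF is_local_repD(2)[OF is_local_rep_wada1] braid_gen_closed[OF k]])
  note gen = is_local_repD(3)[OF is_local_rep_wada1[of n h] k]
  have kk [simp]: "k \<in> {1..n}" "k + 1 \<in> {1..n}" using k by auto
  \<comment> \<open>The index \<open>k\<close> is assigned to \<open>False\<close>, the factor that
    \<open>weight\<close> counts, so that \<open>weight\<close> detects the exponent sum at
    \<open>k\<close>.\<close>
  define t where "t j = (if j = k then word_rotation H False 1
    else if j = k + 1 then word_rotation H True 1 else \<one>\<^bsub>?B\<^esub>)" for j
  have t [simp]: "t j \<in> carrier ?B" for j
    unfolding t_def using H B.one_closed by auto
  define \<Phi> where "\<Phi> = free_lift {1..n} ?B t"
  have \<Phi>_hom: "\<Phi> \<in> hom ?F ?B" unfolding \<Phi>_def by (rule free_lift_hom[OF B.is_group t])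
  interpret \<Phi>: group_hom ?F ?B \<Phi> by (rule group_homI[OF F.is_group B.is_group \<Phi>_hom])
  have \<Phi>_gen: "\<Phi> (basis n j) = t j" if "j \<in> {1..n}" for j
    unfolding \<Phi>_def by (rule free_lift_gen[OF B.is_group t that])
  have flip [simp]: "word_flip H \<in> carrier ?B" by simp
  note [simp del] = carrier_BijGroup one_BijGroup
  have rot [simp]: "word_rotation H i d \<in> carrier ?B" for i d using H by (simp add: carrier_BijGroup)
  have flip2 [simp]: "word_flip H \<otimes>\<^bsub>?B\<^esub> (word_flip H \<otimes>\<^bsub>?B\<^esub> f) = f" if "f \<in> carrier ?B" for f
    using that word_flip_mult_self[OF H] by (simp flip: B.m_assoc)
  have "\<Phi> (?s x) = word_flip H \<otimes>\<^bsub>?B\<^esub> \<Phi> x \<otimes>\<^bsub>?B\<^esub> word_flip H"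
  proof (rule free_group_hom_eqI[OF B.is_group hom_comp[OF s.homh \<Phi>_hom] _ _ x])
    show "(\<lambda>x. word_flip H \<otimes>\<^bsub>?B\<^esub> \<Phi> x \<otimes>\<^bsub>?B\<^esub> word_flip H) \<in> hom ?F ?B"
      by (rule homI) (simp_all add: B.m_assoc)
    fix j assume j: "j \<in> {1..n}"
    have conj: "word_flip H \<otimes>\<^bsub>?B\<^esub> word_rotation H i 1 \<otimes>\<^bsub>?B\<^esub> word_flip H = word_rotation H (\<not> i) 1" for i
      by (simp add: word_flip_rotation[OF H] B.m_assoc word_flip_mult_self[OF H])
    have "word_rotation H i 1 [^]\<^bsub>?B\<^esub> h = \<one>\<^bsub>?B\<^esub>" for i
      by (simp add: word_rotation_int_pow[OF H] word_rotation_dvd[OF H hH])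
    then show "\<Phi> (?s (basis n j)) = word_flip H \<otimes>\<^bsub>?B\<^esub> \<Phi> (basis n j) \<otimes>\<^bsub>?B\<^esub> word_flip H"
      using j by (simp add: gen \<Phi>_gen t_def \<Phi>.hom_int_pow B.int_pow_neg conj word_flip_mult_self[OF H]
          del: atLeastAtMost_iff)
  qed
  then have "\<Phi> x = word_flip H \<otimes>\<^bsub>?B\<^esub> \<Phi> x \<otimes>\<^bsub>?B\<^esub> word_flip H" by (simp only: fixed)
  then have "word_flip H \<otimes>\<^bsub>?B\<^esub> \<Phi> x =
      word_flip H \<otimes>\<^bsub>?B\<^esub> (word_flip H \<otimes>\<^bsub>?B\<^esub> \<Phi> x \<otimes>\<^bsub>?B\<^esub> word_flip H)"
    by (rule arg_cong)
  also have "\<dots> = \<Phi> x \<otimes>\<^bsub>?B\<^esub> word_flip H"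
    using x by (simp add: B.m_assoc)
  finally have "word_flip H \<otimes>\<^bsub>?B\<^esub> \<Phi> x = \<Phi> x \<otimes>\<^bsub>?B\<^esub> word_flip H" .
  \<comment> \<open>The exchange fixes the empty word, so evaluating there turns commutation with it
    into invariance of the reduced word \<open>\<Phi> x []\<close>.\<close>
  then have "(word_flip H \<otimes>\<^bsub>?B\<^esub> \<Phi> x) [] = (\<Phi> x \<otimes>\<^bsub>?B\<^esub> word_flip H) []" by simp
  moreover have Bij: "\<Phi> y \<in> Bij ?\<Omega>" if "y \<in> carrier ?F" for y
    using \<Phi>.hom_closed[OF that] by (simp add: carrier_BijGroup)
  moreover have red: "reduced H (\<Phi> y r)" if "y \<in> carrier ?F" "reduced H r" for y r
    using Bij_imp_funcset[OF Bij[OF that(1)]] that(2) by auto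
  ultimately have "flip_word (\<Phi> x []) = \<Phi> x []"
    using x by (simp add: mult_BijGroup_apply) (simp add: word_flip_def)
  then have "\<Phi> x [] = []" by (rule flip_word_eq_self)
  have weight_gen: "H dvd weight (\<Phi> (basis n j) r) - weight r - expo n k (basis n j)"
    if j: "j \<in> {1..n}" and r: "reduced H r" for j r
  proof -
    consider "j = k" | "j = k + 1" | "j \<noteq> k" "j \<noteq> k + 1" by blast
    then show ?thesis
    proof cases
      case 1
      then show ?thesis
        using weight_rotate_head[OF H r, of False 1] r
        by (simp add: \<Phi>_gen t_def word_rotation_def del: atLeastAtMost_iff)
    next
      case 2
      then show ?thesis
        using weight_rotate_head[OF H r, of True 1] r
        by (simp add: \<Phi>_gen t_def word_rotation_def del: atLeastAtMost_iff)
    next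
      case 3
      then show ?thesis using j r by (simp add: \<Phi>_gen t_def one_BijGroup del: atLeastAtMost_iff)
    qed
  qed
  \<comment> \<open>Stated for every reduced starting word, because a product applies its left
    factor to the result of the right one. In the end both the starting word and its image are
    empty, leaving only the exponent sum.\<close>
  have weight: "H dvd weight (\<Phi> y r) - weight r - expo n k y"
    if "y \<in> generate ?F (free_gen {1..n} ` {1..n})" "reduced H r" for y r
    using that
  proof (induction arbitrary: r rule: generate.induct)
    case one
    then show ?case by (simp add: one_BijGroup)
  next
    case (incl y)
    then obtain j where j: "y = basis n j" "j \<in> {1..n}" by blast
    then show ?case using weight_gen[OF j(2) incl(2)] by simp
  next
    case (inv y)
    then obtain j where j: "y = basis n j" "j \<in> {1..n}" by blast
    have y: "y \<in> carrier ?F" using j by simp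
    \<comment> \<open>The congruence for the generator \<open>y\<close>, applied at
      \<open>r'\<close>, leads back to \<open>r\<close>; negating it gives the case of the
      inverse.\<close>
    define r' where "r' = \<Phi> (inv\<^bsub>?F\<^esub> y) r"
    have r': "reduced H r'" unfolding r'_def by (rule red) (use y inv in auto)
    have "(\<Phi> y \<otimes>\<^bsub>?B\<^esub> \<Phi> (inv\<^bsub>?F\<^esub> y)) r = r"
      using y inv(2) by (simp add: one_BijGroup)
    then have "\<Phi> y r' = r"
      using Bij y inv(2) by (simp add: mult_BijGroup_apply r'_def del: \<Phi>.hom_inv)
    moreover have "H dvd weight (\<Phi> y r') - weight r' - expo n k y"
      using weight_gen[OF j(2) r'] j by simp
    ultimately have "H dvd weight r - weight r' - expo n k y" by simp
    then have "H dvd - (weight r - weight r' - expo n k y)" by (simp only: dvd_minus_iff)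
    then show ?case using y by (simp add: r'_def algebra_simps del: \<Phi>.hom_inv)
  next
    case (eng y z)
    have yz: "y \<in> carrier ?F" "z \<in> carrier ?F" using eng(1,2) by (simp_all add: generate_free_gen)
    have "\<Phi> (y \<otimes>\<^bsub>?F\<^esub> z) r = \<Phi> y (\<Phi> z r)"
      using yz Bij eng(5) by (simp add: mult_BijGroup_apply)
    moreover have "H dvd weight (\<Phi> y (\<Phi> z r)) - weight (\<Phi> z r) - expo n k y + (weight (\<Phi> z r) - weight r - expo n k z)"
      by (rule dvd_add[OF eng(3)[OF red[OF yz(2) eng(5)]] eng(4)[OF eng(5)]])
    ultimately show ?case using yz by (simp add: algebra_simps)
  qed
  have "H dvd expo n k x"
    using weight[of x "[]"] x \<open>\<Phi> x [] = []\<close> by (simp add: generate_free_gen weight_def)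
  then show ?thesis by (simp add: H_def)
qed

lemma dvd_expo_of_fixed:
  assumes "n \<ge> 2" "h \<noteq> 0" "x \<in> fixed_points n (wada1 n h)" "i \<in> {1..n}"
  shows "h dvd expo n i x"
proof -
  have x: "x \<in> carrier (free_rank n)" using assms(3) by (simp add: fixed_points_def)
  have fixed: "wada1 n h (braid_gen n k) x = x" if "k \<in> {1..<n}" for k
    using assms(3) that by (simp add: fixed_points_def del: atLeastLessThan_iff)
  have *: "h dvd expo n k x" if "k \<in> {1..<n}" for k
    by (rule dvd_expo_of_wada1_gen_fixed[OF that assms(2) x fixed[OF that]])
  show ?thesis
  proof (cases "i < n")
    case True
    then show ?thesis using * assms by simp
  next
    case False
    \<comment> \<open>No braid generator has index \<open>n\<close>; invariance under the last one
      equates the exponent sums at \<open>n - 1\<close> and \<open>n\<close>.\<close>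
    define k where "k = n - 1"
    have k: "k \<in> {1..<n}" "i = k + 1" using False assms by (auto simp: k_def)
    then have "expo n i x = expo n k x" using expo_wada1_gen[OF k(1) x, of i h] fixed[OF k(1)] by simp
    then show ?thesis using *[OF k(1)] by simp
  qed
qed

text \<open>For the fixed element \<open>P\<close> of parameter \<open>l\<close>, all exponent sums
  of \<open>f P\<close> are divisible by \<open>k\<close>. The first exponent sum of
  \<open>g (f P)\<close>, which is \<open>l\<close>, is an integer combination of them. Asking only
  for a left inverse of \<open>f\<close> lets an automorphism and its inverse take either
  role.\<close>

lemma dvd_of_fixed_points_embedding:
  assumes n: "n \<ge> 2" and k: "k \<noteq> 0"
    and f: "f \<in> hom (free_rank n) (free_rank n)" and g: "g \<in> hom (free_rank n) (free_rank n)"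
    and gf: "\<And>x. x \<in> carrier (free_rank n) \<Longrightarrow> g (f x) = x"
    and fixed: "\<And>x. x \<in> fixed_points n (wada1 n l) \<Longrightarrow> f x \<in> fixed_points n (wada1 n k)"
  shows "k dvd l"
proof -
  let ?P = "power_product n l n"
  have P: "?P \<in> carrier (free_rank n)" by simp
  have fP: "f ?P \<in> carrier (free_rank n)" by (rule hom_in_carrier[OF f P])
  have "k dvd (\<Sum>i\<in>{1..n}. expo n 1 (g (basis n i)) * expo n i (f ?P))"
    by (intro dvd_sum dvd_mult dvd_expo_of_fixed[OF n k fixed[OF power_product_fixed]])
  also have "\<dots> = expo n 1 (g (f ?P))"
    by (rule hom_integer_group_expo[OF hom_comp[OF g expo_hom] fP, symmetric])
  also have "\<dots> = l" using n by (simp add: gf[OF P] expo_power_product)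
  finally show ?thesis .
qed

lemma eq_or_eq_uminus_if_rep_equivalent_wada1:
  assumes n: "n \<ge> 2" and k: "k \<noteq> 0" and l: "l \<noteq> 0"
    and "rep_equivalent (braid_group n) (free_rank n) (wada1 n k) (wada1 n l)"
  shows "l = k \<or> l = - k"
proof -
  let ?F = "free_rank n" and ?B = "braid_group n"
  note hom_k = is_local_repD(2)[OF is_local_rep_wada1[of n k]]
    and hom_l = is_local_repD(2)[OF is_local_rep_wada1[of n l]]
  interpret F: group ?F by (rule group_free_group)
  obtain \<phi> \<mu> where \<phi>: "\<phi> \<in> auto ?F" and \<mu>: "\<mu> \<in> auto ?B"
    and "\<forall>\<beta>\<in>carrier ?B. \<forall>x\<in>carrier ?F. \<phi> (wada1 n l (\<mu> \<beta>) x) = wada1 n k \<beta> (\<phi> x)"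
    using rep_equivalentD[OF assms(4) hom_k] by (elim bexE) (rule that)
  note eq = this(3)[rule_format]
  let ?\<psi> = "restrict (inv_into (carrier ?F) \<phi>) (carrier ?F)"
  have bij: "bij_betw \<phi> (carrier ?F) (carrier ?F)" by (rule autoD(3)[OF \<phi>])
  have \<phi>_hom: "\<phi> \<in> hom ?F ?F" by (rule autoD(1)[OF \<phi>])
  have \<psi>_hom: "?\<psi> \<in> hom ?F ?F"
    by (rule F.restrict_inv_into_hom[OF \<phi>_hom]) (use \<phi> in \<open>simp add: auto_def\<close>)
  have \<psi>\<phi>: "?\<psi> (\<phi> x) = x" if "x \<in> carrier ?F" for x
    using that auto_closed[OF \<phi> that] bij_betw_inv_into_left[OF bij that] by simp
  have \<phi>\<psi>: "\<phi> (?\<psi> x) = x" if "x \<in> carrier ?F" for x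
    using that bij_betw_inv_into_right[OF bij that] by simp
  have \<mu>_closed: "\<mu> \<beta> \<in> carrier ?B" if "\<beta> \<in> carrier ?B" for \<beta> by (rule auto_closed[OF \<mu> that])
  have "k dvd l"
  proof (rule dvd_of_fixed_points_embedding[OF n k \<phi>_hom \<psi>_hom \<psi>\<phi>])
    fix x assume x: "x \<in> fixed_points n (wada1 n l)"
    then have "wada1 n k \<beta> (\<phi> x) = \<phi> x" if "\<beta> \<in> carrier ?B" for \<beta>
      using eq[OF that, of x] \<mu>_closed[OF that] by (simp add: fixed_points_def)
    then show "\<phi> x \<in> fixed_points n (wada1 n k)"
      using x auto_closed[OF \<phi>] by (simp add: fixed_points_def)
  qed
  moreover have "l dvd k"
  proof (rule dvd_of_fixed_points_embedding[OF n l \<psi>_hom \<phi>_hom \<phi>\<psi>])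
    fix x assume x: "x \<in> fixed_points n (wada1 n k)"
    then have xF: "x \<in> carrier ?F" by (simp add: fixed_points_def)
    have \<psi>x: "?\<psi> x \<in> carrier ?F" by (rule hom_in_carrier[OF \<psi>_hom xF])
    have "wada1 n l \<gamma> (?\<psi> x) = ?\<psi> x" if \<gamma>: "\<gamma> \<in> carrier ?B" for \<gamma>
    proof -
      \<comment> \<open>Surjectivity of \<open>\<mu>\<close> enters here: invariance is known for
        the elements \<open>\<mu> \<beta>\<close> only.\<close>
      obtain \<beta> where \<beta>: "\<beta> \<in> carrier ?B" "\<gamma> = \<mu> \<beta>"
        using \<gamma> autoD(3)[OF \<mu>] unfolding bij_betw_def by blast
      have "\<phi> (wada1 n l \<gamma> (?\<psi> x)) = wada1 n k \<beta> x"
        using eq[OF \<beta>(1) \<psi>x] by (simp only: \<beta>(2) \<phi>\<psi>[OF xF])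
      also have "\<dots> = x" using x \<beta>(1) by (simp add: fixed_points_def)
      finally have "?\<psi> (\<phi> (wada1 n l \<gamma> (?\<psi> x))) = ?\<psi> x" by (rule arg_cong)
      then show ?thesis by (simp only: \<psi>\<phi>[OF braid_rep_closed[OF hom_l \<gamma> \<psi>x]])
    qed
    then show "?\<psi> x \<in> fixed_points n (wada1 n l)"
      using \<psi>x by (simp only: fixed_points_def mem_Collect_eq ball_simps) blast
  qed
  ultimately show ?thesis by (metis abs_eq_iff zdvd_antisym_abs)
qed

section \<open>Types (1) and (2) differ on the abelianization\<close>

text \<open>Conjugation disappears in exponent sums, so each generator acts as a transposition of
  coordinates whatever \<open>h\<close> is, and words in the generators only rearrange coordinates
  further.\<close>

lemma expo_wada1_permuted:
  assumes \<beta>: "\<beta> \<in> carrier (braid_group n)"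
  shows "\<exists>\<pi>\<in>{1..n} \<rightarrow> {1..n}. \<forall>i\<in>{1..n}. \<forall>x\<in>carrier (free_rank n).
    expo n i (wada1 n h \<beta> x) = expo n (\<pi> i) x"
proof -
  note \<rho> = is_local_repD(2)[OF is_local_rep_wada1[of n h]]
  have gens: "braid_gen n ` {1..<n} \<subseteq> carrier (braid_group n)" by auto
  note closed = group.generate_in_carrier[OF group_braid_group gens]
  have "\<beta> \<in> generate (braid_group n) (braid_gen n ` {1..<n})"
    using \<beta> by (simp add: generate_braid_gen)
  then show ?thesis
  proof (induction rule: generate.induct)
    case one
    show ?case by (rule bexI[of _ "\<lambda>i. i"]) (simp_all add: braid_rep_one[OF \<rho>])
  next
    case (incl b)
    then obtain k where k: "b = braid_gen n k" "k \<in> {1..<n}" by blast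
    then show ?case
      by (intro bexI[of _ "\<lambda>i. if i = k then k + 1 else if i = k + 1 then k else i"])
        (auto simp: expo_wada1_gen)
  next
    case (inv b)
    then obtain k where k: "b = braid_gen n k" "k \<in> {1..<n}" by blast
    let ?\<tau> = "\<lambda>i. if i = k then k + 1 else if i = k + 1 then k else i"
    have b: "b \<in> carrier (braid_group n)" using k by simp
    \<comment> \<open>A transposition is its own inverse, so the same index map serves.\<close>
    have "expo n i (wada1 n h (inv\<^bsub>braid_group n\<^esub> b) x) = expo n (?\<tau> i) x"
      if x: "x \<in> carrier (free_rank n)" for i x
    proof -
      have "wada1 n h (inv\<^bsub>braid_group n\<^esub> b) x \<in> carrier (free_rank n)"
        by (rule braid_rep_closed[OF \<rho> group.inv_closed[OF group_braid_group b] x])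
      from expo_wada1_gen[OF k(2) this, of "?\<tau> i" h] show ?thesis
        unfolding k(1)[symmetric] braid_rep_inv(1)[OF \<rho> b x] by (auto split: if_splits)
    qed
    then show ?case using k(2) by (intro bexI[of _ ?\<tau>]) auto
  next
    case (eng b c)
    then obtain \<pi> \<pi>' where \<pi>: "\<pi> \<in> {1..n} \<rightarrow> {1..n}" "\<pi>' \<in> {1..n} \<rightarrow> {1..n}"
      and eq: "\<And>i x. i \<in> {1..n} \<Longrightarrow> x \<in> carrier (free_rank n) \<Longrightarrow> expo n i (wada1 n h b x) = expo n (\<pi> i) x"
        "\<And>i x. i \<in> {1..n} \<Longrightarrow> x \<in> carrier (free_rank n) \<Longrightarrow> expo n i (wada1 n h c x) = expo n (\<pi>' i) x"
      by blast
    have b: "b \<in> carrier (braid_group n)" and c: "c \<in> carrier (braid_group n)"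
      using eng closed by blast+
    \<comment> \<open>Index maps compose in the reverse order: reading coordinate \<open>i\<close>
      after \<open>b\<close> first moves to \<open>\<pi> i\<close>, which is then read after
      \<open>c\<close>.\<close>
    have "expo n i (wada1 n h (b \<otimes>\<^bsub>braid_group n\<^esub> c) x) = expo n (\<pi>' (\<pi> i)) x"
      if i: "i \<in> {1..n}" and x: "x \<in> carrier (free_rank n)" for i x
      unfolding braid_rep_mult[OF \<rho> b x c] eq(1)[OF i braid_rep_closed[OF \<rho> c x]]
      by (rule eq(2)[OF funcset_mem[OF \<pi>(1) i] x])
    moreover have "(\<lambda>i. \<pi>' (\<pi> i)) \<in> {1..n} \<rightarrow> {1..n}" using \<pi> by blast
    ultimately show ?case by (intro bexI[of _ "\<lambda>i. \<pi>' (\<pi> i)"]) blast+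
  qed
qed

text \<open>Along an orbit the exponent sums only take values already occurring for
  \<open>x\<close>. An arbitrary \<open>f\<close> is allowed because exponent sums will be read off
  after applying \<open>\<phi>\<close>.\<close>

lemma hom_wada1_bounded:
  assumes f: "f \<in> hom (free_rank n) integer_group" and x: "x \<in> carrier (free_rank n)"
  shows "\<exists>M. \<forall>\<beta>\<in>carrier (braid_group n). f (wada1 n h \<beta> x) \<le> M"
proof (intro exI ballI)
  note \<rho> = is_local_repD(2)[OF is_local_rep_wada1[of n h]]
  let ?C = "\<Sum>j\<in>{1..n}. \<bar>expo n j x\<bar>"
  fix \<beta> assume \<beta>: "\<beta> \<in> carrier (braid_group n)"
  obtain \<pi> where \<pi>: "\<pi> \<in> {1..n} \<rightarrow> {1..n}"
    and eq: "\<And>i. i \<in> {1..n} \<Longrightarrow> expo n i (wada1 n h \<beta> x) = expo n (\<pi> i) x"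
    using expo_wada1_permuted[OF \<beta>, of h] x by blast
  have bound: "\<bar>expo n i (wada1 n h \<beta> x)\<bar> \<le> ?C" if i: "i \<in> {1..n}" for i
    unfolding eq[OF i] by (rule member_le_sum) (use funcset_mem[OF \<pi> i] in auto)
  have "f (wada1 n h \<beta> x) = (\<Sum>i\<in>{1..n}. f (basis n i) * expo n i (wada1 n h \<beta> x))"
    by (rule hom_integer_group_expo[OF f braid_rep_closed[OF \<rho> \<beta> x]])
  also have "\<dots> \<le> (\<Sum>i\<in>{1..n}. \<bar>f (basis n i)\<bar> * ?C)"
  proof (rule sum_mono)
    fix i assume i: "i \<in> {1..n}"
    have "\<bar>f (basis n i)\<bar> * \<bar>expo n i (wada1 n h \<beta> x)\<bar> \<le> \<bar>f (basis n i)\<bar> * ?C"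
      by (rule mult_left_mono[OF bound[OF i]]) simp
    then show "f (basis n i) * expo n i (wada1 n h \<beta> x) \<le> \<bar>f (basis n i)\<bar> * ?C"
      unfolding abs_mult[symmetric] using abs_ge_self by (rule order_trans[rotated])
  qed
  finally show "f (wada1 n h \<beta> x) \<le> (\<Sum>i\<in>{1..n}. \<bar>f (basis n i)\<bar> * ?C)" .
qed

text \<open>On the first two exponent sums the generator acts by \<open>(a, b)\<close> to
  \<open>(2a + b, -a)\<close>, a nontrivial unipotent map. The induction therefore carries the pair
  \<open>(1 + m, -m)\<close>.\<close>

lemma expo_wada2_pow:
  assumes n: "n \<ge> 2"
  shows "expo n 1 (wada2 n (braid_gen n 1 [^]\<^bsub>braid_group n\<^esub> m) (basis n 1)) = 1 + int m"
proof -
  let ?F = "free_rank n" and ?B = "braid_group n"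
  note \<rho> = is_local_repD(2)[OF is_local_rep_wada2[of n]]
  interpret F: group ?F by (rule group_free_group)
  interpret B: group ?B by (rule group_braid_group)
  have k: "1 \<in> {1..<n}" and [simp]: "1 \<in> {1..n}" "2 \<in> {1..n}" using n by auto
  let ?\<sigma> = "braid_gen n 1"
  have \<sigma>: "?\<sigma> \<in> carrier ?B" by (rule braid_gen_closed[OF k])
  interpret s: group_hom ?F ?F "wada2 n ?\<sigma>" by (rule group_hom_braid_gen[OF \<rho> \<sigma>])
  have gen: "wada2 n ?\<sigma> (basis n i) =
      (if i = 1 then basis n 1 \<otimes>\<^bsub>?F\<^esub> inv\<^bsub>?F\<^esub> basis n 2 \<otimes>\<^bsub>?F\<^esub> basis n 1
       else if i = 2 then basis n 1 else basis n i)" if "i \<in> {1..n}" for i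
    using is_local_repD(3)[OF is_local_rep_wada2[of n] k that] by simp
  have step1: "expo n 1 (wada2 n ?\<sigma> z) = 2 * expo n 1 z + expo n 2 z" if z: "z \<in> carrier ?F" for z
    by (rule free_group_hom_eqI[OF group_integer_group hom_comp[OF s.homh expo_hom] _ _ z])
      (auto intro!: homI simp: gen simp del: atLeastAtMost_iff)
  have step2: "expo n 2 (wada2 n ?\<sigma> z) = - expo n 1 z" if z: "z \<in> carrier ?F" for z
    by (rule free_group_hom_eqI[OF group_integer_group hom_comp[OF s.homh expo_hom] _ _ z])
      (auto intro!: homI simp: gen simp del: atLeastAtMost_iff)
  have "expo n 1 (wada2 n (?\<sigma> [^]\<^bsub>?B\<^esub> m) (basis n 1)) = 1 + int m \<and>
      expo n 2 (wada2 n (?\<sigma> [^]\<^bsub>?B\<^esub> m) (basis n 1)) = - int m"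
  proof (induction m)
    case 0
    then show ?case by (simp add: braid_rep_one[OF \<rho>] del: atLeastAtMost_iff)
  next
    case (Suc m)
    have x: "basis n 1 \<in> carrier ?F" by (rule free_gen_closed) (use n in simp)
    have pow: "?\<sigma> [^]\<^bsub>?B\<^esub> m \<in> carrier ?B" using \<sigma> by simp
    have "?\<sigma> [^]\<^bsub>?B\<^esub> Suc m = ?\<sigma> \<otimes>\<^bsub>?B\<^esub> ?\<sigma> [^]\<^bsub>?B\<^esub> m" using \<sigma> by (rule B.nat_pow_Suc2)
    then show ?case
      using Suc step1[OF braid_rep_closed[OF \<rho> pow x]] step2[OF braid_rep_closed[OF \<rho> pow x]]
      by (simp only: braid_rep_mult[OF \<rho> \<sigma> x pow]) simp
  qed
  then show ?thesis by blast
qed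

lemma not_rep_equivalent_wada2_wada1:
  assumes n: "n \<ge> 2"
  shows "\<not> rep_equivalent (braid_group n) (free_rank n) (wada2 n) (wada1 n h)"
proof
  let ?F = "free_rank n" and ?B = "braid_group n"
  assume equiv: "rep_equivalent ?B ?F (wada2 n) (wada1 n h)"
  obtain \<phi> \<mu> where \<phi>: "\<phi> \<in> auto ?F" and \<mu>: "\<mu> \<in> auto ?B"
    and "\<forall>\<beta>\<in>carrier ?B. \<forall>x\<in>carrier ?F. \<phi> (wada1 n h (\<mu> \<beta>) x) = wada2 n \<beta> (\<phi> x)"
    using rep_equivalentD[OF equiv is_local_repD(2)[OF is_local_rep_wada2]] by (elim bexE) (rule that)
  note eq = this(3)[rule_format]
  have "basis n 1 \<in> carrier ?F" by (rule free_gen_closed) (use n in simp)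
  \<comment> \<open>Chosen so that intertwining sends the type (1) orbit of \<open>w\<close> onto
    the type (2) orbit of \<open>basis n 1\<close>.\<close>
  then obtain w where w: "w \<in> carrier ?F" "\<phi> w = basis n 1"
    using autoD(3)[OF \<phi>] unfolding bij_betw_def by (metis imageE)
  obtain M where M: "\<And>\<beta>. \<beta> \<in> carrier ?B \<Longrightarrow> expo n 1 (\<phi> (wada1 n h \<beta> w)) \<le> M"
    using hom_wada1_bounded[OF hom_comp[OF autoD(1)[OF \<phi>] expo_hom] w(1), of 1 h] by blast
  \<comment> \<open>The exponent sum at this power is \<open>1 + nat M\<close>, which exceeds the
    bound \<open>M\<close> even when \<open>M\<close> is negative.\<close>
  let ?\<beta> = "braid_gen n 1 [^]\<^bsub>?B\<^esub> nat M"
  have \<beta>: "?\<beta> \<in> carrier ?B"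
    using n by (intro monoid.nat_pow_closed[OF group.is_monoid[OF group_braid_group]] braid_gen_closed) simp
  have "1 + int (nat M) = expo n 1 (\<phi> (wada1 n h (\<mu> ?\<beta>) w))"
    unfolding eq[OF \<beta> w(1)] w(2) by (rule expo_wada2_pow[OF n, symmetric])
  also have "\<dots> \<le> M" by (rule M[OF auto_closed[OF \<mu> \<beta>]])
  finally show False by (simp split: if_splits)
qed

theorem propositionA1:
  fixes n :: nat
  assumes "n \<ge> 2"
  shows "(\<forall>k l :: int. k \<noteq> 0 \<longrightarrow> l \<noteq> 0 \<longrightarrow>
            (rep_equivalent (braid_group n) (free_group {1..n}) (wada1 n k) (wada1 n l) \<longleftrightarrow>
             l = k \<or> l = - k)) \<and>
         rep_equivalent (braid_group n) (free_group {1..n}) (wada2 n) (wada3 n) \<and>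
         (\<forall>k :: int. k \<noteq> 0 \<longrightarrow>
            \<not> rep_equivalent (braid_group n) (free_group {1..n}) (wada2 n) (wada1 n k))"
  using eq_or_eq_uminus_if_rep_equivalent_wada1[OF assms] rep_equivalent_refl_wada1
    rep_equivalent_wada1_uminus rep_equivalent_wada2_wada3 not_rep_equivalent_wada2_wada1[OF assms]
  by blast

end
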